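(* Consider the distributed stochastic approximation scheme described in the context, with iterates $\{x_k\}$. Assume that the sets $X_i\subseteq\mathbb{R}^{n_i}$ are closed and convex, that $F$ is strongly monotone with constant $\eta>0$ and Lipschitz continuous with constant $L$ over $X=\prod_{i=1}^NX_i$, and that for some constant $\nu>0$, $\mathsf{E}[\|w_k\|^2\mid\mathcal{F}_k]\le\nu^2$ almost surely for all $k\ge0$. Assume that $X$ is bounded, with $D=\max_{x,y\in X}\|x-y\|$ a positive constant, and that $D<\sqrt{2}\,\frac{\nu}{L}$. Let $c$ be an arbitrary fixed constant with $0<c<\frac{\eta}{2}$ and, for each player $i=1,\dots,N$, let $r_i$ be an arbitrary parameter with $r_i\in\bigl[1,1+\frac{\eta-2c}{L}\bigr]$. Suppose that the stepsizes of player $i$, $i=1,\dots,N$, are given by $$\gamma_{0,i}=r_i\,\frac{c}{\bigl(1+\frac{\eta-2c}{L}\bigr)^2\nu^2}\,D^2,\qquad \gamma_{k,i}=\gamma_{k-1,i}\Bigl(1-\frac{c}{r_i}\gamma_{k-1,i}\Bigr)\quad\text{for all }k\ge1.$$ Set $\beta=\frac{\eta-2c}{L}$ and $e_0=D^2$, and define $$\delta_0^*=\frac{\eta-\beta L}{2(1+\beta)^2\nu^2}\,e_0,\qquad \delta_k^*=\delta_{k-1}^*\Bigl(1-\frac{\eta-\beta L}{2}\,\delta_{k-1}^*\Bigr)\quad(k\ge1),$$ $$\Gamma_0^*=\frac{\eta-\beta L}{2(1+\beta)\nu^2}\,e_0,\qquad \Gamma_k^*=\Gamma_{k-1}^*\Bigl(1-\frac{\eta-\beta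 L}{2(1+\beta)}\,\Gamma_{k-1}^*\Bigr)\quad(k\ge1).$$ Then the following hold: (a) $\frac{\gamma_{k,i}}{r_i}=\frac{\gamma_{k,j}}{r_j}$ for any $i,j=1,\dots,N$ and $k\ge0$. (b) $0\le\beta<\frac{\eta}{L}$, and for all $k\ge0$: $\delta_k^*$ and $\Gamma_k^*$ are positive, $\delta_k^*\le\min_{i=1,\dots,N}\gamma_{k,i}$, $\Gamma_k^*\ge\max_{i=1,\dots,N}\gamma_{k,i}$, and $\frac{\Gamma_k^*-\delta_k^*}{\delta_k^*}\le\beta$. (c) The sequence $\{x_k\}$ generated by the scheme converges almost surely to the unique solution of VI$(X,F)$. (d) Let $e_k(\delta_0,\dots,\delta_{k-1})$ be defined recursively from the constant $e_0=D^2$ by $$e_{k+1}(\delta_0,\dots,\delta_k)=(1-(\eta-\beta L)\delta_k)\,e_k(\delta_0,\dots,\delta_{k-1})+(1+\beta)^2\delta_k^2\nu^2\quad(k\ge0).$$ Then $e_k(\delta_0^*,\dots,\delta_{k-1}^* )=\frac{2(1+\beta)^2\nu^2}{\eta-\beta L}\,\delta_k^*$ for all $k\ge0$ (the left side being $e_0$ for $k=0$), and for every $k\ge1$ the vector $(\delta_0^*,\dots,\delta_{k-1}^* )$ is the minimizer of $e_k$ over $$\mathbb{G}_k=\Bigl\{\alpha\in\mathbb{R}^k:0<\alpha_j\le\frac{\eta-\beta L}{(1+\beta)^2L^2},\ j=1,\dots,k\Bigr\},$$ i.e., for every $(\delta_0,\dots,\delta_{k-1})\in\mathbb{G}_k$,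 $$e_k(\delta_0,\dots,\delta_{k-1})-e_k(\delta_0^*,\dots,\delta_{k-1}^* )\ge(1+\beta)^2\nu^2(\delta_{k-1}-\delta_{k-1}^* )^2.$$
   Context: Setting. There are $N$ players; player $i$ chooses $x_i\in X_i\subseteq\mathbb{R}^{n_i}$ to minimize $\mathsf{E}[f_i(x_i,x_{-i},\xi_i)]$, where $\xi_i$ is a random vector and $x_{-i}=\{x_j:j\ne i\}$; this expected cost is strongly convex in $x_i$ for all $x_{-i}\in\prod_{j\neq i}X_j$. Put $n=\sum_i n_i$, $X=\prod_{i=1}^N X_i\subseteq\mathbb{R}^n$, $x=(x_1,\dots,x_N)$, $\hat F(x,\xi)=(\nabla_{x_1}f_1(x,\xi_1),\dots,\nabla_{x_N}f_N(x,\xi_N))$ with $\xi=(\xi_1,\dots,\xi_N)$, and $F(x)=(F_1(x),\dots,F_N(x))$ with $F_i(x)=\nabla_{x_i}\mathsf{E}[f_i(x,\xi_i)]=\mathsf{E}[\nabla_{x_i}f_i(x,\xi_i)]$. A vector $x^*\in X$ solves VI$(X,F)$ if $(x-x^* )^TF(x^* )\ge0$ for all $x\in X$; its solutions characterize the equilibria of the game. Norm: $\|\cdot\|$ is Euclidean; $\Pi_{X_i}$ is the Euclidean projection onto $X_i$. $F$ is strongly monotone on $X$ with constant $\eta$ if $(F(x)-F(y))^T(x-y)\ge\eta\|x-y\|^2$ for all $x,y\in X$, and Lipschitz with constant $L$ if $\|F(x)-F(y)\|\le L\|x-y\|$ for all $x,y\in X$. Scheme. For $k\ge0$ and $i=1,\dots,N$,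 $$x_{k+1,i}=\Pi_{X_i}\bigl(x_{k,i}-\gamma_{k,i}(F_i(x_k)+w_{k,i})\bigr),\qquad w_{k,i}=\hat F_i(x_k,\xi_k)-F_i(x_k),$$ where $\gamma_{k,i}$ is the deterministic stepsize of player $i$ at iteration $k$, $x_k=(x_{k,1},\dots,x_{k,N})$, $w_k=(w_{k,1},\dots,w_{k,N})$, and $\xi_k=(\xi_{k,1},\dots,\xi_{k,N})$ is the sample of $\xi$ at iteration $k$. The initial vector $x_0\in X$ is random, independent of the samples, with $\mathsf{E}[\|x_0\|^2]<\infty$. The history is $\mathcal{F}_0=\{x_0\}$ and $\mathcal{F}_k=\{x_0,\xi_0,\dots,\xi_{k-1}\}$ for $k\ge1$ (conditioning on $\mathcal{F}_k$ means on the generated $\sigma$-algebra). The errors satisfy $\mathsf{E}[w_{k,i}\mid\mathcal{F}_k]=0$ for all $k,i$. *)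

theory Defs
  imports "HOL-Probability.Probability"
begin

text \<open>
  The blocks of a vector \<open>x = (x\<^sub>1, \<dots>, x\<^sub>N)\<close> have different dimensions, so they cannot all be given
  one type \<open>real ^ 'm\<close>. Instead \<open>own :: 'n \<Rightarrow> 'p\<close> assigns each coordinate of the full space to a
  player: \<open>N\<close> is \<open>CARD('p)\<close>, \<open>n\<^sub>i\<close> is the cardinality of the fibre of \<open>own\<close> over \<open>i\<close>, and \<open>\<real>\<^sup>n\<^sup>i\<close> is
  identified (isometrically, by padding with zeros) with \<open>block_space own i\<close>.
\<close>

definition block_space :: "('n::finite \<Rightarrow> 'p) \<Rightarrow> 'p \<Rightarrow> (real ^ 'n) set" where
  "block_space own i = {v. \<forall>j. own j \<noteq> i \<longrightarrow> v $ j = 0}"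

definition block :: "('n::finite \<Rightarrow> 'p) \<Rightarrow> 'p \<Rightarrow> real ^ 'n \<Rightarrow> real ^ 'n" where
  "block own i x = (\<chi> j. if own j = i then x $ j else 0)"

text \<open>\<open>block_update own i x y\<close> is \<open>(y\<^sub>i, x\<^sub>-\<^sub>i)\<close>.\<close>

definition block_update :: "('n::finite \<Rightarrow> 'p) \<Rightarrow> 'p \<Rightarrow> real ^ 'n \<Rightarrow> real ^ 'n \<Rightarrow> real ^ 'n" where
  "block_update own i x y = (\<chi> j. if own j = i then y $ j else x $ j)"

definition block_prod :: "('n::finite \<Rightarrow> 'p) \<Rightarrow> ('p \<Rightarrow> (real ^ 'n) set) \<Rightarrow> (real ^ 'n) set" where
  "block_prod own Xs = {x. \<forall>i. block own i x \<in> Xs i}"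

text \<open>
  The partial gradient of \<open>g\<close> in the block \<open>x\<^sub>i\<close>. As the differentiated function ignores the other
  blocks of its argument, the gradient lies in \<open>block_space own i\<close>.
\<close>

definition has_block_gradient ::
    "('n::finite \<Rightarrow> 'p) \<Rightarrow> 'p \<Rightarrow> (real ^ 'n \<Rightarrow> real) \<Rightarrow> real ^ 'n \<Rightarrow> real ^ 'n \<Rightarrow> bool" where
  "has_block_gradient own i g x D \<longleftrightarrow> gderiv (\<lambda>y. g (block_update own i x y)) x D"

definition block_gradient ::
    "('n::finite \<Rightarrow> 'p) \<Rightarrow> 'p \<Rightarrow> (real ^ 'n \<Rightarrow> real) \<Rightarrow> real ^ 'n \<Rightarrow> real ^ 'n" where
  "block_gradient own i g x = (THE D. has_block_gradient own i g x D)"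

lemma has_block_gradient_unique:
  assumes "has_block_gradient own i g x D" "has_block_gradient own i g x D'"
  shows "D = D'"
proof -
  have "(\<lambda>h. h \<bullet> D) = (\<lambda>h. h \<bullet> D')"
    using assms unfolding has_block_gradient_def gderiv_def by (rule has_derivative_unique)
  then have "\<forall>h. h \<bullet> D = h \<bullet> D'" by (simp add: fun_eq_iff)
  then show ?thesis by (simp only: vector_eq_ldot)
qed

lemma block_gradient_eq: "has_block_gradient own i g x D \<Longrightarrow> block_gradient own i g x = D"
  unfolding block_gradient_def by (rule the_equality) (simp_all add: has_block_gradient_unique)

lemma has_block_gradient_in_block_space:
  assumes "has_block_gradient own i g x D"
  shows "D \<in> block_space own i"
proof -
  let ?G = "\<lambda>y. g (block_update own i x y)"
  have G: "(?G has_derivative (\<lambda>h. h \<bullet> D)) (at x)"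
    using assms unfolding has_block_gradient_def gderiv_def .
  have "D $ j = 0" if "own j \<noteq> i" for j
  proof -
    have "((\<lambda>t. x + t *\<^sub>R axis j 1) has_derivative (\<lambda>t. t *\<^sub>R axis j 1)) (at (0::real))"
      by (auto intro!: derivative_eq_intros)
    moreover have "(?G has_derivative (\<lambda>h. h \<bullet> D)) (at (x + (0::real) *\<^sub>R axis j 1))"
      using G by simp
    ultimately have
      "((\<lambda>t. ?G (x + t *\<^sub>R axis j 1)) has_derivative (\<lambda>t. (t *\<^sub>R axis j 1) \<bullet> D)) (at (0::real))"
      by (rule has_derivative_compose)
    moreover have "block_update own i x (x + t *\<^sub>R axis j 1) = x" for t
      using that by (auto simp: block_update_def vec_eq_iff axis_def)
    ultimately have "((\<lambda>t. g x) has_derivative (\<lambda>t. (t *\<^sub>R axis j 1) \<bullet> D)) (at (0::real))"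
      by simp
    then have "(\<lambda>t::real. (t *\<^sub>R axis j 1) \<bullet> D) = (\<lambda>t. 0)"
      by (rule has_derivative_unique) (rule has_derivative_const)
    then have "(1 *\<^sub>R axis j 1) \<bullet> D = 0" by (rule fun_cong)
    then show ?thesis by (simp add: inner_axis')
  qed
  then show ?thesis by (simp add: block_space_def)
qed

text \<open>
  The random vector \<open>\<xi> = (\<xi>\<^sub>1, \<dots>, \<xi>\<^sub>N)\<close> is split into blocks by \<open>sown\<close> in the same way.
\<close>

definition expected_cost ::
    "'a measure \<Rightarrow> ('d::finite \<Rightarrow> 'p) \<Rightarrow> ('p \<Rightarrow> real ^ 'n \<Rightarrow> real ^ 'd \<Rightarrow> real) \<Rightarrow>
     ('a \<Rightarrow> real ^ 'd) \<Rightarrow> 'p \<Rightarrow> real ^ 'n \<Rightarrow> real" where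
  "expected_cost M sown f \<xi> i x = (\<integral>\<omega>. f i x (block sown i (\<xi> \<omega>)) \<partial>M)"

definition sampled_map ::
    "('n::finite \<Rightarrow> 'p) \<Rightarrow> ('d::finite \<Rightarrow> 'p) \<Rightarrow> ('p \<Rightarrow> real ^ 'n \<Rightarrow> real ^ 'd \<Rightarrow> real) \<Rightarrow>
     real ^ 'n \<Rightarrow> real ^ 'd \<Rightarrow> real ^ 'n" where
  "sampled_map own sown f x s =
    (\<chi> j. block_gradient own (own j) (\<lambda>y. f (own j) y (block sown (own j) s)) x $ j)"

definition mean_map ::
    "'a measure \<Rightarrow> ('n::finite \<Rightarrow> 'p) \<Rightarrow> ('d::finite \<Rightarrow> 'p) \<Rightarrow>
     ('p \<Rightarrow> real ^ 'n \<Rightarrow> real ^ 'd \<Rightarrow> real) \<Rightarrow> ('a \<Rightarrow> real ^ 'd) \<Rightarrow> real ^ 'n \<Rightarrow> real ^ 'n" where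
  "mean_map M own sown f \<xi> x =
    (\<chi> j. block_gradient own (own j) (expected_cost M sown f \<xi> (own j)) x $ j)"

definition noise ::
    "'a measure \<Rightarrow> ('n::finite \<Rightarrow> 'p) \<Rightarrow> ('d::finite \<Rightarrow> 'p) \<Rightarrow>
     ('p \<Rightarrow> real ^ 'n \<Rightarrow> real ^ 'd \<Rightarrow> real) \<Rightarrow> ('a \<Rightarrow> real ^ 'd) \<Rightarrow>
     (nat \<Rightarrow> 'a \<Rightarrow> real ^ 'd) \<Rightarrow> (nat \<Rightarrow> 'a \<Rightarrow> real ^ 'n) \<Rightarrow> nat \<Rightarrow> 'a \<Rightarrow> real ^ 'n" where
  "noise M own sown f \<xi> \<xi>s x k \<omega> =
    sampled_map own sown f (x k \<omega>) (\<xi>s k \<omega>) - mean_map M own sown f \<xi> (x k \<omega>)"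

text \<open>The \<open>\<sigma>\<close>-algebra generated by \<open>x\<^sub>0, \<xi>\<^sub>0, \<dots>, \<xi>\<^sub>k\<^sub>-\<^sub>1\<close>.\<close>

definition history ::
    "'a measure \<Rightarrow> ('a \<Rightarrow> 'b::topological_space) \<Rightarrow> (nat \<Rightarrow> 'a \<Rightarrow> 'c::topological_space) \<Rightarrow>
     nat \<Rightarrow> 'a measure" where
  "history M x0 \<xi>s k = sigma (space M)
    ({x0 -` A \<inter> space M | A. A \<in> sets borel} \<union>
     (\<Union>j<k. {\<xi>s j -` A \<inter> space M | A. A \<in> sets borel}))"

definition strongly_convex_on :: "'a::real_normed_vector set \<Rightarrow> ('a \<Rightarrow> real) \<Rightarrow> bool" where
  "strongly_convex_on S g \<longleftrightarrow>
    (\<exists>\<mu>>0. \<forall>x\<in>S. \<forall>y\<in>S. \<forall>t\<in>{0..1}.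
      g ((1 - t) *\<^sub>R x + t *\<^sub>R y) \<le> (1 - t) * g x + t * g y - \<mu> / 2 * t * (1 - t) * (norm (x - y))\<^sup>2)"

definition strongly_monotone_on :: "real \<Rightarrow> 'a::real_inner set \<Rightarrow> ('a \<Rightarrow> 'a) \<Rightarrow> bool" where
  "strongly_monotone_on \<eta> S F \<longleftrightarrow>
    (\<forall>x\<in>S. \<forall>y\<in>S. (F x - F y) \<bullet> (x - y) \<ge> \<eta> * (norm (x - y))\<^sup>2)"

definition solves_VI :: "'a::real_inner set \<Rightarrow> ('a \<Rightarrow> 'a) \<Rightarrow> 'a \<Rightarrow> bool" where
  "solves_VI S F z \<longleftrightarrow> z \<in> S \<and> (\<forall>x\<in>S. (x - z) \<bullet> F z \<ge> 0)"

text \<open>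
  The sets \<open>X\<^sub>i\<close> may have empty interior, and gradients are taken in all of \<open>\<real>\<^sup>n\<^sup>i\<close>; so the cost has
  to be defined and integrable in a neighbourhood (in \<open>x\<^sub>i\<close>) of every point of \<open>X\<close>. Measurability of
  the sampled gradient is what makes the iterates of the scheme random vectors.
\<close>

locale stochastic_game = prob_space M
  for M :: "'a measure" +
  fixes own :: "'n::finite \<Rightarrow> 'p::finite"
    and sown :: "'d::finite \<Rightarrow> 'p"
    and f :: "'p \<Rightarrow> real ^ 'n \<Rightarrow> real ^ 'd \<Rightarrow> real"
    and \<xi> :: "'a \<Rightarrow> real ^ 'd"
    and Xs :: "'p \<Rightarrow> (real ^ 'n) set"
  assumes surj_own: "surj own"
    and Xs_block: "Xs i \<subseteq> block_space own i"
    and \<xi>_measurable: "random_variable borel \<xi>"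
    and cost_integrable: "x \<in> block_prod own Xs \<Longrightarrow>
      \<forall>\<^sub>F y in nhds x. integrable M (\<lambda>\<omega>. f i (block_update own i x y) (block sown i (\<xi> \<omega>)))"
    and expected_cost_strongly_convex: "x \<in> block_prod own Xs \<Longrightarrow>
      strongly_convex_on (Xs i) (\<lambda>u. expected_cost M sown f \<xi> i (block_update own i x u))"
    and cost_differentiable: "AE s in distr M borel \<xi>. \<forall>x\<in>block_prod own Xs. \<forall>i.
      \<exists>D. has_block_gradient own i (\<lambda>y. f i y (block sown i s)) x D"
    and expected_cost_differentiable: "x \<in> block_prod own Xs \<Longrightarrow>
      \<exists>D. has_block_gradient own i (expected_cost M sown f \<xi> i) x D"
    and sampled_map_measurable: "(\<lambda>(x, s). sampled_map own sown f x s)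
      \<in> borel_measurable (restrict_space borel (block_prod own Xs) \<Otimes>\<^sub>M borel)"
    and sampled_map_integrable: "x \<in> block_prod own Xs \<Longrightarrow>
      integrable M (\<lambda>\<omega>. sampled_map own sown f x (\<xi> \<omega>))"
    and mean_map_eq: "x \<in> block_prod own Xs \<Longrightarrow>
      mean_map M own sown f \<xi> x = expectation (\<lambda>\<omega>. sampled_map own sown f x (\<xi> \<omega>))"

text \<open>
  No independence of the samples \<open>\<xi>s 0, \<xi>s 1, \<dots>\<close> among themselves is required, only that the
  errors are conditionally unbiased. Conditional expectations of vectors are taken componentwise.
\<close>

locale stochastic_approximation = stochastic_game M own sown f \<xi> Xs
  for M :: "'a measure"
    and own :: "'n::finite \<Rightarrow> 'p::finite"
    and sown :: "'d::finite \<Rightarrow> 'p"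
    and f :: "'p \<Rightarrow> real ^ 'n \<Rightarrow> real ^ 'd \<Rightarrow> real"
    and \<xi> :: "'a \<Rightarrow> real ^ 'd"
    and Xs :: "'p \<Rightarrow> (real ^ 'n) set" +
  fixes \<gamma> :: "nat \<Rightarrow> 'p \<Rightarrow> real"
    and \<xi>s :: "nat \<Rightarrow> 'a \<Rightarrow> real ^ 'd"
    and x :: "nat \<Rightarrow> 'a \<Rightarrow> real ^ 'n"
  assumes samples_measurable: "random_variable borel (\<xi>s k)"
    and samples_distr: "distr M borel (\<xi>s k) = distr M borel \<xi>"
    and x0_measurable: "random_variable borel (x 0)"
    and x0_in: "\<omega> \<in> space M \<Longrightarrow> x 0 \<omega> \<in> block_prod own Xs"
    and x0_square_integrable: "integrable M (\<lambda>\<omega>. (norm (x 0 \<omega>))\<^sup>2)"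
    and x0_indep: "indep_set {x 0 -` A \<inter> space M | A. A \<in> sets borel}
      {(\<lambda>\<omega> k. \<xi>s k \<omega>) -` B \<inter> space M | B. B \<in> sets (\<Pi>\<^sub>M k\<in>UNIV. borel)}"
    and step: "\<omega> \<in> space M \<Longrightarrow>
      block own i (x (Suc k) \<omega>) =
        closest_point (Xs i) (block own i (x k \<omega>) -
          \<gamma> k i *\<^sub>R (block own i (mean_map M own sown f \<xi> (x k \<omega>)) +
                   block own i (noise M own sown f \<xi> \<xi>s x k \<omega>)))"
    and noise_integrable: "integrable M (noise M own sown f \<xi> \<xi>s x k)"
    and noise_unbiased: "AE \<omega> in M. \<forall>j.
      real_cond_exp M (history M (x 0) \<xi>s k) (\<lambda>\<omega>. noise M own sown f \<xi> \<xi>s x k \<omega> $ j) \<omega> = 0"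

end

theory Submission
  imports Defs
begin

text \<open>
  The stepsizes are \<open>\<gamma> k i = r i * \<delta> k\<close> and \<open>\<Gamma> k = (1 + \<beta>) * \<delta> k\<close>, where \<open>\<eta> - \<beta> * L = 2 * c\<close>.
  Minimality of \<open>\<delta>\<close> follows by completing the square in the recursion of \<open>e\<close>:
  \<open>e (k+1) \<alpha> - e (k+1) \<delta> = (1 - 2 c \<alpha> k) (e k \<alpha> - e k \<delta>) + (1 + \<beta>)\<^sup>2 \<nu>\<^sup>2 (\<alpha> k - \<delta> k)\<^sup>2\<close>.

  For the almost sure convergence let \<open>z\<close> solve the variational inequality. Blockwise
  nonexpansiveness of the projections shows that \<open>V k = (norm (x k - z))\<^sup>2\<close> satisfies
  \<open>E[V (k+1) | F k] \<le> (1 - 2 c \<delta> k) V k + (1 + \<beta>)\<^sup>2 \<nu>\<^sup>2 (\<delta> k)\<^sup>2\<close>. Hence \<open>E[V k] \<le> e k \<delta>\<close>, a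
  constant multiple of \<open>\<delta> k\<close>, which tends to zero. Since \<open>(\<delta> k)\<^sup>2\<close> is summable, \<open>V\<close> is
  a supermartingale up to a summable error, and the maximal inequality upgrades convergence in
  mean to almost sure convergence.
\<close>

section \<open>Maximal inequality and conditional moments\<close>

text \<open>Doob's maximal inequality over an infinite horizon, obtained by stopping at the first
  time from \<open>n\<close> on at which the level \<open>l\<close> is reached. The supermartingale
  property is tested on events of \<open>H k\<close>, so conditional expectations of
  \<open>U\<close> never appear.\<close>

lemma (in prob_space) nonneg_supermartingale_maximal:
  fixes U :: "nat \<Rightarrow> 'a \<Rightarrow> real"
  assumes subalg: "\<And>k. subalgebra M (H k)"
    and mono: "\<And>k. sets (H k) \<subseteq> sets (H (Suc k))"
    and adapted: "\<And>k. U k \<in> borel_measurable (H k)"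
    and int: "\<And>k. integrable M (U k)"
    and nonneg: "\<And>k \<omega>. \<omega> \<in> space M \<Longrightarrow> 0 \<le> U k \<omega>"
    and super: "\<And>k A. A \<in> sets (H k) \<Longrightarrow>
      (\<integral>\<omega>. indicator A \<omega> * U (Suc k) \<omega> \<partial>M) \<le> (\<integral>\<omega>. indicator A \<omega> * U k \<omega> \<partial>M)"
    and l: "0 < l"
  shows "l * prob {\<omega> \<in> space M. \<exists>k\<ge>n. l \<le> U k \<omega>} \<le> expectation (U n)"
proof -
  \<comment> \<open>\<open>S m\<close> is the event that the level has not been reached at the times
    \<open>n\<close> to \<open>n + m\<close>; it is known at time \<open>n + m\<close>, so
    \<open>super\<close> may be applied on it.\<close>
  define S where "S m = {\<omega> \<in> space M. \<forall>k\<in>{n..n + m}. U k \<omega> < l}" for m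
  have space_H: "space (H k) = space M" for k
    using subalg[of k] by (simp add: subalgebra_def)
  have S_Suc: "S (Suc m) = S m \<inter> {\<omega> \<in> space M. U (Suc (n + m)) \<omega> < l}" for m
    by (auto simp: S_def le_Suc_eq)
  have lt_sets: "{\<omega> \<in> space M. U k \<omega> < l} \<in> sets (H k)" for k
  proof -
    have [measurable]: "U k \<in> borel_measurable (H k)" by (rule adapted)
    have "{\<omega> \<in> space (H k). U k \<omega> < l} \<in> sets (H k)" by measurable
    then show ?thesis by (simp add: space_H)
  qed
  have S_H: "S m \<in> sets (H (n + m))" for m
  proof (induction m)
    case 0
    have "S 0 = {\<omega> \<in> space M. U n \<omega> < l}" by (auto simp: S_def)
    then show ?case using lt_sets[of n] by simp
  next
    case (Suc m)
    then show ?case using mono[of "n + m"] lt_sets[of "Suc (n + m)"] by (auto simp: S_Suc)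
  qed
  then have S_M [measurable]: "S m \<in> sets M" for m
    using subalg by (auto simp: subalgebra_def)
  have U_M [measurable]: "U k \<in> borel_measurable M" for k
    using int by auto
  have intI: "integrable M (\<lambda>\<omega>. indicator A \<omega> * U k \<omega>)" if "A \<in> sets M" for A k
    using integrable_mult_indicator[OF that int[of k]] by simp
  have int2: "integrable M (\<lambda>\<omega>. l * indicator A \<omega> + indicator B \<omega> * U k \<omega>)"
    if "A \<in> sets M" "B \<in> sets M" for A B k
    using intI[OF that(2)] that(1) by (auto simp: emeasure_eq_measure)
  \<comment> \<open>The left side is a lower bound for the mean of the process stopped at first
    passage, with its value there replaced by \<open>l\<close>. Going from \<open>m\<close> to
    \<open>m + 1\<close> uses \<open>super\<close> on \<open>S m\<close> and then splits
    \<open>S m\<close> into the paths that pass \<open>l\<close> at the new time and those that do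
    not.\<close>
  have stop: "l * prob (space M - S m) + (\<integral>\<omega>. indicator (S m) \<omega> * U (n + m) \<omega> \<partial>M)
    \<le> expectation (U n)" for m
  proof (induction m)
    case 0
    have "l * prob (space M - S 0) + (\<integral>\<omega>. indicator (S 0) \<omega> * U n \<omega> \<partial>M)
        = (\<integral>\<omega>. l * indicator (space M - S 0) \<omega> + indicator (S 0) \<omega> * U n \<omega> \<partial>M)"
      using intI by (subst Bochner_Integration.integral_add)
        (auto simp: Int_absorb1 emeasure_eq_measure)
    also have "\<dots> \<le> expectation (U n)"
      using int by (intro integral_mono int2) (auto simp: S_def indicator_def)
    finally show ?case by simp
  next
    case (Suc m)
    let ?k = "Suc (n + m)"
    have sub: "S (Suc m) \<subseteq> S m" by (auto simp: S_Suc)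
    have "l * prob (S m - S (Suc m)) + (\<integral>\<omega>. indicator (S (Suc m)) \<omega> * U ?k \<omega> \<partial>M)
        = (\<integral>\<omega>. l * indicator (S m - S (Suc m)) \<omega> + indicator (S (Suc m)) \<omega> * U ?k \<omega> \<partial>M)"
      using intI by (subst Bochner_Integration.integral_add)
        (auto simp: Int_absorb1 emeasure_eq_measure)
    also have "\<dots> \<le> (\<integral>\<omega>. indicator (S m) \<omega> * U ?k \<omega> \<partial>M)"
      by (intro integral_mono int2 intI) (auto simp: S_Suc indicator_def)
    also have "\<dots> \<le> (\<integral>\<omega>. indicator (S m) \<omega> * U (n + m) \<omega> \<partial>M)"
      by (rule super[OF S_H])
    finally have "l * prob (S m - S (Suc m)) + (\<integral>\<omega>. indicator (S (Suc m)) \<omega> * U ?k \<omega> \<partial>M)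
      \<le> (\<integral>\<omega>. indicator (S m) \<omega> * U (n + m) \<omega> \<partial>M)" .
    moreover have "prob (space M - S (Suc m)) = prob (space M - S m) + prob (S m - S (Suc m))"
      using sub by (simp add: prob_compl finite_measure_Diff)
    ultimately show ?case using Suc by (simp add: algebra_simps)
  qed
  have bound: "l * prob (space M - S m) \<le> expectation (U n)" for m
  proof -
    have "0 \<le> (\<integral>\<omega>. indicator (S m) \<omega> * U (n + m) \<omega> \<partial>M)"
      using nonneg by (intro integral_nonneg_AE AE_I2) (auto simp: indicator_def)
    then show ?thesis using stop[of m] by linarith
  qed
  \<comment> \<open>The bound is uniform in \<open>m\<close>, so continuity from below removes the
    finite horizon.\<close>
  have "incseq (\<lambda>m. space M - S m)"
    by (rule incseq_SucI) (auto simp: S_Suc)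
  then have "(\<lambda>m. prob (space M - S m)) \<longlonglongrightarrow> prob (\<Union>m. space M - S m)"
    by (intro finite_Lim_measure_incseq) auto
  moreover have "(\<Union>m. space M - S m) = {\<omega> \<in> space M. \<exists>k\<ge>n. l \<le> U k \<omega>}"
  proof (intro set_eqI iffI)
    fix \<omega> assume "\<omega> \<in> {\<omega> \<in> space M. \<exists>k\<ge>n. l \<le> U k \<omega>}"
    then obtain k where "\<omega> \<in> space M" "k \<ge> n" "l \<le> U k \<omega>" by auto
    then have "\<omega> \<in> space M - S (k - n)" by (auto simp: S_def not_less intro!: bexI[of _ k])
    then show "\<omega> \<in> (\<Union>m. space M - S m)" by blast
  next
    fix \<omega> assume "\<omega> \<in> (\<Union>m. space M - S m)"
    then show "\<omega> \<in> {\<omega> \<in> space M. \<exists>k\<ge>n. l \<le> U k \<omega>}" by (auto simp: S_def not_less)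
  qed
  ultimately have "(\<lambda>m. l * prob (space M - S m)) \<longlonglongrightarrow> l * prob {\<omega> \<in> space M. \<exists>k\<ge>n. l \<le> U k \<omega>}"
    by (auto intro: tendsto_mult_left)
  then show ?thesis by (rule LIMSEQ_le_const2) (use bound in blast)
qed

lemma (in prob_space) almost_supermartingale_tendsto_zero:
  fixes V :: "nat \<Rightarrow> 'a \<Rightarrow> real"
  assumes subalg: "\<And>k. subalgebra M (H k)"
    and mono: "\<And>k. sets (H k) \<subseteq> sets (H (Suc k))"
    and adapted: "\<And>k. V k \<in> borel_measurable (H k)"
    and int: "\<And>k. integrable M (V k)"
    and nonneg: "\<And>k \<omega>. \<omega> \<in> space M \<Longrightarrow> 0 \<le> V k \<omega>"
    and super: "\<And>k A. A \<in> sets (H k) \<Longrightarrow>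
      (\<integral>\<omega>. indicator A \<omega> * V (Suc k) \<omega> \<partial>M) \<le> (\<integral>\<omega>. indicator A \<omega> * V k \<omega> \<partial>M) + a k * prob A"
    and a_nonneg: "\<And>k. 0 \<le> a k"
    and a_summable: "summable a"
    and lim: "(\<lambda>k. expectation (V k)) \<longlonglongrightarrow> 0"
  shows "AE \<omega> in M. (\<lambda>k. V k \<omega>) \<longlonglongrightarrow> 0"
proof -
  \<comment> \<open>Adding the tail sums of \<open>a\<close> turns \<open>V\<close> into a genuine nonnegative supermartingale \<open>U\<close>.\<close>
  define T where "T k = (\<Sum>j. a (j + k))" for k
  define U where "U k \<omega> = V k \<omega> + T k" for k \<omega>
  have T_summable: "summable (\<lambda>j. a (j + k))" for k
    using a_summable by (simp add: summable_iff_shift)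
  have T_nonneg: "0 \<le> T k" for k
    unfolding T_def using T_summable a_nonneg by (intro suminf_nonneg) auto
  have T_Suc: "T k = a k + T (Suc k)" for k
    unfolding T_def using suminf_split_head[OF T_summable[of k]] by simp
  have T_lim: "T \<longlonglongrightarrow> 0"
    unfolding T_def by (rule suminf_exist_split2[OF a_summable])
  have U_int: "integrable M (U k)" for k
    unfolding U_def using int by auto
  have U_nonneg: "0 \<le> U k \<omega>" if "\<omega> \<in> space M" for k \<omega>
    unfolding U_def using nonneg[OF that] T_nonneg by (simp add: add_nonneg_nonneg)
  have U_split: "(\<integral>\<omega>. indicator A \<omega> * U k \<omega> \<partial>M) = (\<integral>\<omega>. indicator A \<omega> * V k \<omega> \<partial>M) + T k * prob A"
    if "A \<in> sets M" for A k
  proof -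
    have "(\<integral>\<omega>. indicator A \<omega> * U k \<omega> \<partial>M)
        = (\<integral>\<omega>. indicator A \<omega> * V k \<omega> + T k * indicator A \<omega> \<partial>M)"
      by (simp add: U_def algebra_simps)
    also have "\<dots> = (\<integral>\<omega>. indicator A \<omega> * V k \<omega> \<partial>M) + T k * prob A"
      using that integrable_mult_indicator[OF that int[of k]]
      by (subst Bochner_Integration.integral_add)
        (auto simp: emeasure_eq_measure Int_absorb2[OF sets.sets_into_space])
    finally show ?thesis .
  qed
  have maximal: "l * prob {\<omega> \<in> space M. \<exists>k\<ge>n. l \<le> U k \<omega>} \<le> expectation (V n) + T n"
    if "0 < l" for l n
  proof -
    have "l * prob {\<omega> \<in> space M. \<exists>k\<ge>n. l \<le> U k \<omega>} \<le> expectation (U n)"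
    proof (rule nonneg_supermartingale_maximal[where H = H and U = U, OF subalg mono _ U_int U_nonneg _ that])
      show "U k \<in> borel_measurable (H k)" for k
        unfolding U_def using adapted by auto
    next
      fix k A assume A: "A \<in> sets (H k)"
      then have "A \<in> sets M" using subalg by (auto simp: subalgebra_def)
      then show "(\<integral>\<omega>. indicator A \<omega> * U (Suc k) \<omega> \<partial>M) \<le> (\<integral>\<omega>. indicator A \<omega> * U k \<omega> \<partial>M)"
        using super[OF A] by (simp add: U_split T_Suc[of k] algebra_simps)
    qed
    also have "expectation (U n) = expectation (V n) + T n"
      unfolding U_def using int by (simp add: prob_space)
    finally show ?thesis .
  qed
  have [measurable]: "U k \<in> borel_measurable M" for k
    using U_int by auto
  \<comment> \<open>A path that reaches \<open>l\<close> infinitely often reaches it after every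
    \<open>n\<close>, so the maximal inequality bounds the probability of such paths by
    \<open>(expectation (V n) + T n) / l\<close>, which tends to zero.\<close>
  have "AE \<omega> in M. \<exists>n. \<forall>k\<ge>n. U k \<omega> < l" if l: "0 < l" for l
  proof -
    let ?N = "{\<omega> \<in> space M. \<not> (\<exists>n. \<forall>k\<ge>n. U k \<omega> < l)}"
    have "l * prob ?N \<le> expectation (V n) + T n" for n
    proof -
      have "prob ?N \<le> prob {\<omega> \<in> space M. \<exists>k\<ge>n. l \<le> U k \<omega>}"
        by (intro finite_measure_mono) (auto simp: not_less)
      with maximal[OF l, of n] l show ?thesis
        by (meson order_trans mult_left_mono less_imp_le)
    qed
    moreover have "(\<lambda>n. expectation (V n) + T n) \<longlonglongrightarrow> 0 + 0"
      by (intro tendsto_add lim T_lim)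
    ultimately have "l * prob ?N \<le> 0 + 0"
      by (intro LIMSEQ_le_const[where x = "0 + 0"]) auto
    then have "prob ?N = 0"
      using l by (simp add: mult_le_0_iff measure_le_0_iff)
    then have "AE \<omega> in M. \<omega> \<notin> ?N"
      by (intro AE_not_in) (auto simp: null_sets_def emeasure_eq_measure)
    then show ?thesis by (rule AE_mp) (intro AE_I2 impI; simp)
  qed
  \<comment> \<open>The exceptional set depends on the level; restricting to the levels 1/(i+1)
    leaves countably many null sets.\<close>
  then have "AE \<omega> in M. \<forall>i::nat. \<exists>n. \<forall>k\<ge>n. U k \<omega> < inverse (real (Suc i))"
    by (subst AE_all_countable) auto
  then show ?thesis
  proof (rule AE_mp, intro AE_I2 impI)
    fix \<omega> assume \<omega>: "\<omega> \<in> space M"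
      and small: "\<forall>i::nat. \<exists>n. \<forall>k\<ge>n. U k \<omega> < inverse (real (Suc i))"
    show "(\<lambda>k. V k \<omega>) \<longlonglongrightarrow> 0"
    proof (rule LIMSEQ_I)
      fix \<epsilon> :: real assume "0 < \<epsilon>"
      then obtain i where i: "inverse (real (Suc i)) < \<epsilon>" using reals_Archimedean by blast
      from small obtain n where n: "\<forall>k\<ge>n. U k \<omega> < inverse (real (Suc i))" by blast
      have "norm (V k \<omega> - 0) < \<epsilon>" if "k \<ge> n" for k
      proof -
        have "V k \<omega> \<le> U k \<omega>" using T_nonneg[of k] by (simp add: U_def)
        moreover have "U k \<omega> < inverse (real (Suc i))" using n that by blast
        ultimately show ?thesis using i nonneg[OF \<omega>, of k] by simp
      qed
      then show "\<exists>n. \<forall>k\<ge>n. norm (V k \<omega> - 0) < \<epsilon>" by blast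
    qed
  qed
qed

text \<open>The nonnegative conditional expectation makes sense before \<open>w\<close> is known to
  be square integrable. Integrability is then the case of the whole space, and only afterwards can
  the bound on \<open>A\<close> be restated with Bochner integrals.\<close>

lemma (in prob_space) second_moment_of_nn_cond_exp_bound:
  fixes w :: "'a \<Rightarrow> 'b::{second_countable_topology, real_normed_vector}"
  assumes subalg: "subalgebra M H"
    and [measurable]: "random_variable borel w"
    and bound: "AE \<omega> in M. nn_cond_exp M H (\<lambda>\<omega>. ennreal ((norm (w \<omega>))\<^sup>2)) \<omega> \<le> ennreal (\<nu>\<^sup>2)"
  shows square_integrable_of_nn_cond_exp_bound: "integrable M (\<lambda>\<omega>. (norm (w \<omega>))\<^sup>2)"
    and "A \<in> sets H \<Longrightarrow> (\<integral>\<omega>. indicator A \<omega> * (norm (w \<omega>))\<^sup>2 \<partial>M) \<le> \<nu>\<^sup>2 * prob A"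
proof -
  interpret H: finite_measure_subalgebra M H
    by unfold_locales (rule subalg)
  let ?q = "\<lambda>\<omega>. ennreal ((norm (w \<omega>))\<^sup>2)"
  have set_bound: "(\<integral>\<^sup>+\<omega>. indicator A \<omega> * ?q \<omega> \<partial>M) \<le> ennreal (\<nu>\<^sup>2 * prob A)" if "A \<in> sets H" for A
  proof -
    have A: "A \<in> sets M" using that subalg by (auto simp: subalgebra_def)
    have "(\<integral>\<^sup>+\<omega>. indicator A \<omega> * ?q \<omega> \<partial>M) = (\<integral>\<^sup>+\<omega>. indicator A \<omega> * nn_cond_exp M H ?q \<omega> \<partial>M)"
      using that by (intro H.nn_cond_exp_intg[symmetric]) auto
    also have "\<dots> \<le> (\<integral>\<^sup>+\<omega>. ennreal (\<nu>\<^sup>2) * indicator A \<omega> \<partial>M)"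
      using bound by (intro nn_integral_mono_AE) (auto elim!: eventually_mono split: split_indicator)
    also have "\<dots> = ennreal (\<nu>\<^sup>2 * prob A)"
      using A by (simp add: nn_integral_cmult_indicator emeasure_eq_measure ennreal_mult)
    finally show ?thesis .
  qed
  have "(\<integral>\<^sup>+\<omega>. ?q \<omega> \<partial>M) = (\<integral>\<^sup>+\<omega>. indicator (space H) \<omega> * ?q \<omega> \<partial>M)"
    using subalg by (intro nn_integral_cong) (auto simp: subalgebra_def)
  also have "\<dots> < \<infinity>"
    using set_bound[OF sets.top] by (rule le_less_trans) simp
  finally show sq: "integrable M (\<lambda>\<omega>. (norm (w \<omega>))\<^sup>2)"
    by (intro integrableI_bounded) auto
  assume A: "A \<in> sets H"
  then have A': "A \<in> sets M" using subalg by (auto simp: subalgebra_def)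
  have "ennreal (\<integral>\<omega>. indicator A \<omega> * (norm (w \<omega>))\<^sup>2 \<partial>M)
      = (\<integral>\<^sup>+\<omega>. ennreal (indicator A \<omega> * (norm (w \<omega>))\<^sup>2) \<partial>M)"
    using integrable_mult_indicator[OF A' sq]
    by (intro nn_integral_eq_integral[symmetric]) (auto simp: indicator_def)
  also have "\<dots> = (\<integral>\<^sup>+\<omega>. indicator A \<omega> * ?q \<omega> \<partial>M)"
    by (intro nn_integral_cong) (auto split: split_indicator)
  also have "\<dots> \<le> ennreal (\<nu>\<^sup>2 * prob A)" by (rule set_bound[OF A])
  finally show "(\<integral>\<omega>. indicator A \<omega> * (norm (w \<omega>))\<^sup>2 \<partial>M) \<le> \<nu>\<^sup>2 * prob A"
    by simp
qed

text \<open>This removes the cross term between the noise and the past. Boundedness of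
  \<open>u\<close> makes the product integrable when \<open>w\<close> is merely integrable, and then
  \<open>u\<close> can be taken out of the conditional expectation.\<close>

lemma (in prob_space) bounded_mult_conditionally_centred:
  fixes u w :: "'a \<Rightarrow> real"
  assumes subalg: "subalgebra M H"
    and u: "u \<in> borel_measurable H" "\<And>\<omega>. \<omega> \<in> space M \<Longrightarrow> \<bar>u \<omega>\<bar> \<le> C"
    and w: "integrable M w" "AE \<omega> in M. real_cond_exp M H w \<omega> = 0"
  shows "integrable M (\<lambda>\<omega>. u \<omega> * w \<omega>)" and "expectation (\<lambda>\<omega>. u \<omega> * w \<omega>) = 0"
proof -
  interpret H: finite_measure_subalgebra M H
    by unfold_locales (rule subalg)
  have [measurable]: "u \<in> borel_measurable M"
    by (rule measurable_from_subalg[OF subalg u(1)])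
  show int: "integrable M (\<lambda>\<omega>. u \<omega> * w \<omega>)"
  proof (rule Bochner_Integration.integrable_bound)
    show "integrable M (\<lambda>\<omega>. C * \<bar>w \<omega>\<bar>)" using w by auto
    show "AE \<omega> in M. norm (u \<omega> * w \<omega>) \<le> norm (C * \<bar>w \<omega>\<bar>)"
    proof (intro AE_I2)
      fix \<omega> assume "\<omega> \<in> space M"
      then have "\<bar>u \<omega> * w \<omega>\<bar> \<le> C * \<bar>w \<omega>\<bar>"
        unfolding abs_mult by (intro mult_right_mono u) auto
      then show "norm (u \<omega> * w \<omega>) \<le> norm (C * \<bar>w \<omega>\<bar>)"
        unfolding real_norm_def by (rule order_trans[OF _ abs_ge_self])
    qed
  qed (use w in measurable)
  have "expectation (\<lambda>\<omega>. u \<omega> * w \<omega>) = expectation (\<lambda>\<omega>. u \<omega> * real_cond_exp M H w \<omega>)"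
    using w by (intro H.real_cond_exp_intg(2)[symmetric] int u) auto
  also have "\<dots> = expectation (\<lambda>\<omega>. 0)"
    using w(2) by (intro integral_cong_AE) (auto simp: measurable_from_subalg[OF subalg])
  finally show "expectation (\<lambda>\<omega>. u \<omega> * w \<omega>) = 0" by simp
qed

section \<open>Projections and variational inequalities on block products\<close>

lemma block_nth [simp]: "block own i x $ j = (if own j = i then x $ j else 0)"
  by (simp add: block_def)

lemma inner_eq_sum_block:
  fixes own :: "'n::finite \<Rightarrow> 'p::finite"
  shows "x \<bullet> y = (\<Sum>i\<in>UNIV. block own i x \<bullet> block own i y)"
proof -
  have "(\<Sum>i\<in>UNIV. block own i x \<bullet> block own i y)
      = (\<Sum>i\<in>UNIV. \<Sum>j\<in>UNIV. if own j = i then x $ j * y $ j else 0)"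
    by (intro sum.cong refl) (auto simp: inner_vec_def intro!: sum.cong)
  also have "\<dots> = x \<bullet> y"
    by (subst sum.swap) (simp add: inner_vec_def)
  finally show ?thesis by simp
qed

text \<open>The blocks are mutually orthogonal, so estimates made player by player combine into one
  for the full vector without losing a constant.\<close>

lemma norm_le_if_norm_block_le:
  fixes own :: "'n::finite \<Rightarrow> 'p::finite"
  assumes "\<And>i. norm (block own i x) \<le> norm (block own i y)"
  shows "norm x \<le> norm y"
proof (rule power2_le_imp_le)
  show "(norm x)\<^sup>2 \<le> (norm y)\<^sup>2"
    unfolding power2_norm_eq_inner inner_eq_sum_block[of x x own] inner_eq_sum_block[of y y own]
    using assms by (intro sum_mono) (simp flip: power2_norm_eq_inner add: power_mono)
qed simp

lemma closed_block_prod: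
  fixes own :: "'n::finite \<Rightarrow> 'p"
  assumes "\<And>i. closed (Xs i)"
  shows "closed (block_prod own Xs)"
proof -
  have "linear (block own i)" for i
    by (rule linearI) (auto simp: vec_eq_iff)
  then have "closed (block own i -` Xs i)" for i
    using assms by (intro closed_vimage linear_continuous_on linear_conv_bounded_linear[THEN iffD1])
  moreover have "block_prod own Xs = (\<Inter>i. block own i -` Xs i)"
    by (auto simp: block_prod_def)
  ultimately show ?thesis by auto
qed

lemma convex_block_prod:
  fixes own :: "'n::finite \<Rightarrow> 'p"
  assumes "\<And>i. convex (Xs i)"
  shows "convex (block_prod own Xs)"
proof -
  have "linear (block own i)" for i
    by (rule linearI) (auto simp: vec_eq_iff)
  then have "convex (block own i -` Xs i)" for i
    using assms by (intro convex_linear_vimage)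
  moreover have "block_prod own Xs = (\<Inter>i. block own i -` Xs i)"
    by (auto simp: block_prod_def)
  ultimately show ?thesis by (auto intro: convex_INT)
qed

lemma closest_point_eqI:
  fixes S :: "'a::euclidean_space set"
  assumes "convex S" "closed S" "x \<in> S" "\<And>y. y \<in> S \<Longrightarrow> 0 \<le> (x - a) \<bullet> (y - x)"
  shows "closest_point S a = x"
proof (rule closest_point_unique[OF assms(1-3), symmetric], intro ballI)
  fix y assume "y \<in> S"
  have "(norm (a - y))\<^sup>2 = (norm (a - x))\<^sup>2 + 2 * ((x - a) \<bullet> (y - x)) + (norm (y - x))\<^sup>2"
    by (simp add: power2_norm_eq_inner algebra_simps inner_commute)
  then have "(norm (a - x))\<^sup>2 \<le> (norm (a - y))\<^sup>2"
    using assms(4)[OF \<open>y \<in> S\<close>] by simp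
  then show "dist a x \<le> dist a y"
    by (simp add: dist_norm)
qed

text \<open>Brouwer's theorem applied to the projected step \<open>x - F x\<close>: by the obtuse
  angle property of projections, each fixed point of this map solves the variational
  inequality.\<close>

lemma solves_VI_exists:
  fixes S :: "'a::euclidean_space set"
  assumes "compact S" "convex S" "S \<noteq> {}" "continuous_on S F"
  shows "\<exists>z. solves_VI S F z"
proof -
  have cl: "closed S" using assms(1) by (rule compact_imp_closed)
  have "continuous_on S (\<lambda>x. closest_point S (x - F x))"
    by (rule continuous_on_compose2[OF continuous_on_closest_point[of S UNIV]])
      (use assms cl in \<open>auto intro!: continuous_intros\<close>)
  moreover have "(\<lambda>x. closest_point S (x - F x)) \<in> S \<rightarrow> S"
    using assms cl by (auto intro: closest_point_in_set)
  ultimately obtain z where z: "z \<in> S" "closest_point S (z - F z) = z"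
    by (rule brouwer[OF assms(1-3)])
  have "0 \<le> (x - z) \<bullet> F z" if "x \<in> S" for x
    using closest_point_dot[OF assms(2) cl that, of "z - F z"] z
    by (simp add: inner_commute)
  with z show ?thesis unfolding solves_VI_def by blast
qed

text \<open>Each solution is inserted as a test point into the inequality of the other. The sum
  contradicts strong monotonicity unless the two coincide.\<close>

lemma solves_VI_unique:
  assumes "strongly_monotone_on \<eta> S F" "0 < \<eta>" "solves_VI S F y" "solves_VI S F z"
  shows "y = z"
proof -
  have "\<eta> * (norm (y - z))\<^sup>2 \<le> (F y - F z) \<bullet> (y - z)"
    using assms by (auto simp: strongly_monotone_on_def solves_VI_def)
  also have "\<dots> = - ((z - y) \<bullet> F y) - (y - z) \<bullet> F z"
    by (simp add: algebra_simps inner_commute)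
  also have "\<dots> \<le> 0"
  proof -
    have "0 \<le> (z - y) \<bullet> F y" "0 \<le> (y - z) \<bullet> F z"
      using assms(3,4) by (simp_all add: solves_VI_def)
    then show ?thesis by linarith
  qed
  finally show ?thesis
    using assms(2) by (simp add: mult_le_0_iff)
qed

text \<open>A solution is stationary for the projected step of each player separately, whatever the
  stepsize \<open>g\<close>. This is what allows stepsizes that differ between players.\<close>

lemma solves_VI_block_fixed:
  fixes own :: "'n::finite \<Rightarrow> 'p"
  assumes z: "solves_VI (block_prod own Xs) F z"
    and "convex (Xs i)" "closed (Xs i)" "Xs i \<subseteq> block_space own i" "0 \<le> g"
  shows "closest_point (Xs i) (block own i z - g *\<^sub>R block own i (F z)) = block own i z"
proof (rule closest_point_eqI[OF assms(2,3)])
  show "block own i z \<in> Xs i"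
    using z by (simp add: solves_VI_def block_prod_def)
next
  fix y assume y: "y \<in> Xs i"
  \<comment> \<open>Changing only block \<open>i\<close> of \<open>z\<close> stays in the product
    set and isolates the \<open>i\<close>-th block of the inequality.\<close>
  let ?x = "block_update own i z y"
  have "block own k ?x = (if k = i then y else block own k z)" for k
    using y assms(4) by (auto simp: vec_eq_iff block_update_def block_space_def)
  then have "?x \<in> block_prod own Xs"
    using z y by (auto simp: block_prod_def solves_VI_def)
  then have "0 \<le> (?x - z) \<bullet> F z"
    using z by (simp add: solves_VI_def)
  also have "(?x - z) \<bullet> F z = block own i (F z) \<bullet> (y - block own i z)"
    using y assms(4) unfolding inner_vec_def
    by (intro sum.cong refl) (auto simp: block_update_def block_space_def)
  finally show "0 \<le> (block own i z - (block own i z - g *\<^sub>R block own i (F z))) \<bullet> (y - block own i z)"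
    using assms(5) by simp
qed

text \<open>Since \<open>z\<close> is fixed by the same blockwise step, nonexpansiveness of each
  projection compares \<open>x'\<close> with \<open>z\<close>. The product of vectors is
  componentwise, so the stepsize vector acts as a diagonal matrix that is constant on every
  block.\<close>

lemma projected_step_le:
  fixes own :: "'n::finite \<Rightarrow> 'p::finite"
  assumes z: "solves_VI (block_prod own Xs) F z"
    and Xs: "\<And>i. convex (Xs i)" "\<And>i. closed (Xs i)" "\<And>i. Xs i \<subseteq> block_space own i"
    and g: "\<And>i. 0 \<le> g i"
    and step: "\<And>i. block own i x' = closest_point (Xs i) (block own i x - g i *\<^sub>R block own i s)"
  shows "norm (x' - z) \<le> norm (x - z - (\<chi> j. g (own j)) * (s - F z))"
proof (rule norm_le_if_norm_block_le[of own])
  fix i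
  have "block own i z \<in> Xs i"
    using z by (simp add: solves_VI_def block_prod_def)
  then have "Xs i \<noteq> {}" by blast
  have "norm (block own i (x' - z)) = norm (block own i x' - block own i z)"
    by (rule arg_cong[where f = norm]) (auto simp: vec_eq_iff)
  also have "\<dots> = dist (closest_point (Xs i) (block own i x - g i *\<^sub>R block own i s))
      (closest_point (Xs i) (block own i z - g i *\<^sub>R block own i (F z)))"
    using solves_VI_block_fixed[OF z Xs(1-3) g] by (simp add: step dist_norm)
  also have "\<dots> \<le> dist (block own i x - g i *\<^sub>R block own i s) (block own i z - g i *\<^sub>R block own i (F z))"
    by (rule closest_point_lipschitz) fact+
  also have "\<dots> = norm (block own i (x - z - (\<chi> j. g (own j)) * (s - F z)))"
    unfolding dist_norm by (rule arg_cong[where f = norm]) (auto simp: vec_eq_iff algebra_simps)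
  finally show "norm (block own i (x' - z))
    \<le> norm (block own i (x - z - (\<chi> j. g (own j)) * (s - F z)))" .
qed

lemma norm_scaled_le:
  fixes g v :: "real ^ 'n"
  assumes "\<And>j. \<bar>g $ j\<bar> \<le> C"
  shows "norm (g * v) \<le> C * norm v"
proof -
  have "0 \<le> C" using order_trans[OF abs_ge_zero assms] .
  have "norm (g * v) \<le> norm (C *\<^sub>R v)"
    by (rule norm_le_componentwise_cart)
      (use assms \<open>0 \<le> C\<close> in \<open>auto simp: abs_mult mult_right_mono\<close>)
  then show ?thesis using \<open>0 \<le> C\<close> by simp
qed

text \<open>The scaling is split into the common stepsize \<open>\<delta>\<close> and a remainder of
  size at most \<open>\<beta> * \<delta>\<close>. The common part gains \<eta> by strong
  monotonicity, and the remainder costs at most \<open>\<beta> * L\<close> by Cauchy-Schwarz. The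
  cross term counts twice in the square, and \<open>small\<close> lets the quadratic term use up
  only one of the two.\<close>

lemma scaled_step_contraction:
  fixes u v g :: "real ^ 'n"
  assumes mono: "\<eta> * (norm u)\<^sup>2 \<le> u \<bullet> v"
    and lip: "norm v \<le> L * norm u"
    and g: "\<And>j. \<delta> \<le> g $ j" "\<And>j. g $ j \<le> (1 + \<beta>) * \<delta>"
    and pos: "0 \<le> \<delta>" "0 \<le> \<beta>"
    and small: "(1 + \<beta>)\<^sup>2 * L\<^sup>2 * \<delta> \<le> \<eta> - \<beta> * L"
  shows "(norm (u - g * v))\<^sup>2 \<le> (1 - (\<eta> - \<beta> * L) * \<delta>) * (norm u)\<^sup>2"
proof -
  define h where "h = g - (\<chi> j. \<delta>)"
  have "norm (h * v) \<le> (\<beta> * \<delta>) * norm v"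
    using g by (intro norm_scaled_le) (auto simp: h_def algebra_simps)
  also have "\<dots> \<le> (\<beta> * \<delta>) * (L * norm u)"
    using lip pos by (intro mult_left_mono) auto
  finally have h: "norm (h * v) \<le> \<beta> * \<delta> * (L * norm u)" .
  have "\<bar>u \<bullet> (h * v)\<bar> \<le> norm u * norm (h * v)" by (rule Cauchy_Schwarz_ineq2)
  also have "\<dots> \<le> norm u * (\<beta> * \<delta> * (L * norm u))" by (intro mult_left_mono h) simp
  finally have "\<bar>u \<bullet> (h * v)\<bar> \<le> \<delta> * (\<beta> * L) * (norm u)\<^sup>2"
    by (simp add: power2_eq_square ac_simps)
  moreover have "u \<bullet> (g * v) = \<delta> * (u \<bullet> v) + u \<bullet> (h * v)"
    by (simp add: h_def inner_vec_def sum_distrib_left algebra_simps flip: sum.distrib)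
  moreover have "\<delta> * (\<eta> * (norm u)\<^sup>2) \<le> \<delta> * (u \<bullet> v)"
    using mono pos by (intro mult_left_mono)
  ultimately have cross: "\<delta> * (\<eta> - \<beta> * L) * (norm u)\<^sup>2 \<le> u \<bullet> (g * v)"
    by (simp add: algebra_simps)
  have "norm (g * v) \<le> ((1 + \<beta>) * \<delta>) * norm v"
    using g pos by (intro norm_scaled_le) (simp add: abs_of_nonneg order_trans[OF pos(1)])
  also have "\<dots> \<le> ((1 + \<beta>) * \<delta>) * (L * norm u)"
    using lip pos by (intro mult_left_mono) auto
  finally have "(norm (g * v))\<^sup>2 \<le> (((1 + \<beta>) * \<delta>) * (L * norm u))\<^sup>2"
    by (intro power_mono) auto
  also have "\<dots> = ((1 + \<beta>)\<^sup>2 * L\<^sup>2 * \<delta>) * (\<delta> * (norm u)\<^sup>2)"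
    by (simp add: power2_eq_square ac_simps)
  also have "\<dots> \<le> (\<eta> - \<beta> * L) * (\<delta> * (norm u)\<^sup>2)"
    using small pos by (intro mult_right_mono) auto
  finally have sq: "(norm (g * v))\<^sup>2 \<le> (\<eta> - \<beta> * L) * (\<delta> * (norm u)\<^sup>2)" .
  have "(norm (u - g * v))\<^sup>2 = (norm u)\<^sup>2 - 2 * (u \<bullet> (g * v)) + (norm (g * v))\<^sup>2"
    by (simp add: power2_norm_eq_inner algebra_simps inner_commute)
  then show ?thesis using cross sq by (simp add: algebra_simps)
qed

section \<open>The stepsize and error recursions\<close>

text \<open>The recursion says that \<open>d k - d (Suc k)\<close> equals
  \<open>c * (d k)\<^sup>2\<close>, so the squares telescope, their sum is at most
  \<open>d 0 / c\<close>, and the terms must tend to zero.\<close>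

lemma quadratic_recursion:
  fixes d :: "nat \<Rightarrow> real"
  assumes Suc: "\<And>k. d (Suc k) = d k * (1 - c * d k)"
    and "0 < c" "0 < d 0" "c * d 0 < 1"
  shows quadratic_recursion_pos: "0 < d k"
    and quadratic_recursion_le: "d k \<le> d 0"
    and quadratic_recursion_square_summable: "summable (\<lambda>k. (d k)\<^sup>2)"
    and quadratic_recursion_tendsto_zero: "d \<longlonglongrightarrow> 0"
proof -
  have bounds: "0 < d k \<and> d k \<le> d 0" for k
  proof (induction k)
    case (Suc k)
    then have "c * d k < 1"
      using assms by (meson le_less_trans mult_left_mono less_imp_le)
    with Suc have "0 < d (Suc k)" by (simp add: assms(1))
    moreover have "d (Suc k) \<le> d k"
      using Suc \<open>0 < c\<close> by (simp add: assms(1) mult_le_cancel_left1)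
    ultimately show ?case using Suc by simp
  qed (use assms in auto)
  then show "0 < d k" "d k \<le> d 0" by auto
  have "(\<Sum>i<n. (d i)\<^sup>2) = (d 0 - d n) / c" for n
    using \<open>0 < c\<close> by (induction n) (simp_all add: Suc field_simps power2_eq_square)
  then have "(\<Sum>i<n. (d i)\<^sup>2) \<le> d 0 / c" for n
    using bounds[of n] \<open>0 < c\<close> by (simp add: divide_right_mono)
  then show "summable (\<lambda>k. (d k)\<^sup>2)"
    by (intro summableI_nonneg_bounded) auto
  then have "(\<lambda>k. sqrt ((d k)\<^sup>2)) \<longlonglongrightarrow> sqrt 0"
    by (intro tendsto_real_sqrt summable_LIMSEQ_zero)
  moreover have "\<bar>d k\<bar> = d k" for k
    using bounds[of k] by simp
  ultimately show "d \<longlonglongrightarrow> 0" by simp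
qed

text \<open>For a fixed previous error \<open>E\<close>, the next error is a quadratic in the
  stepsize with minimum at \<open>a * E / (2 * B)\<close>. If \<open>E\<close> is
  \<open>e k \<delta>\<close>, this minimum is exactly \<open>\<delta> k\<close>, and the recursion
  for \<delta> preserves that relation.\<close>

lemma error_recursion_optimal:
  fixes e :: "nat \<Rightarrow> (nat \<Rightarrow> real) \<Rightarrow> real" and \<delta> :: "nat \<Rightarrow> real"
  assumes e_Suc: "\<And>k \<alpha>. e (Suc k) \<alpha> = (1 - a * \<alpha> k) * e k \<alpha> + B * (\<alpha> k)\<^sup>2"
    and e_0: "\<And>\<alpha>. e 0 \<alpha> = 2 * B / a * \<delta> 0"
    and \<delta>_Suc: "\<And>k. \<delta> (Suc k) = \<delta> k * (1 - a / 2 * \<delta> k)"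
    and a: "0 < a" and B: "0 < B"
  shows error_recursion_optimal_value: "e k \<delta> = 2 * B / a * \<delta> k"
    and error_recursion_diff: "e (Suc k) \<alpha> - e (Suc k) \<delta>
      = (1 - a * \<alpha> k) * (e k \<alpha> - e k \<delta>) + B * (\<alpha> k - \<delta> k)\<^sup>2"
    and error_recursion_nonneg: "(\<And>j. j < k \<Longrightarrow> a * \<alpha> j < 1) \<Longrightarrow> 0 \<le> e k \<alpha> - e k \<delta>"
    and error_recursion_unique:
      "(\<And>j. j < k \<Longrightarrow> a * \<alpha> j < 1) \<Longrightarrow> e k \<alpha> \<le> e k \<delta> \<Longrightarrow> j < k \<Longrightarrow> \<alpha> j = \<delta> j"
    and error_recursion_cong: "(\<And>j. j < k \<Longrightarrow> \<alpha> j = \<alpha>' j) \<Longrightarrow> e k \<alpha> = e k \<alpha>'"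
proof -
  show opt: "e k \<delta> = 2 * B / a * \<delta> k" for k
  proof (induction k)
    case (Suc k)
    then show ?case using a by (simp add: e_Suc \<delta>_Suc) (simp add: field_simps power2_eq_square)
  qed (simp add: e_0)
  have diff: "e (Suc k) \<alpha> - e (Suc k) \<delta>
      = (1 - a * \<alpha> k) * (e k \<alpha> - e k \<delta>) + B * (\<alpha> k - \<delta> k)\<^sup>2" for k \<alpha>
    using a unfolding opt e_Suc[of k \<alpha>] \<delta>_Suc by (simp add: field_simps power2_eq_square)
  then show "e (Suc k) \<alpha> - e (Suc k) \<delta>
      = (1 - a * \<alpha> k) * (e k \<alpha> - e k \<delta>) + B * (\<alpha> k - \<delta> k)\<^sup>2" .
  have nonneg: "0 \<le> e k \<alpha> - e k \<delta>" if "\<And>j. j < k \<Longrightarrow> a * \<alpha> j < 1" for k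
    using that
  proof (induction k)
    case (Suc k)
    then have "0 \<le> e k \<alpha> - e k \<delta>" "a * \<alpha> k < 1" by auto
    then show ?case unfolding diff using B
      by (intro add_nonneg_nonneg mult_nonneg_nonneg) auto
  qed (simp add: e_0)
  then show "(\<And>j. j < k \<Longrightarrow> a * \<alpha> j < 1) \<Longrightarrow> 0 \<le> e k \<alpha> - e k \<delta>" .
  \<comment> \<open>Both summands of the gap are nonnegative, so a gap that is not positive makes
    both vanish. The strict bound \<open>a * \<alpha> k < 1\<close> then forces the gap at
    \<open>k\<close> to be zero as well, and the argument descends to the earlier stepsizes.\<close>
  show "\<alpha> j = \<delta> j" if "\<And>j. j < k \<Longrightarrow> a * \<alpha> j < 1" "e k \<alpha> \<le> e k \<delta>" "j < k"
    using that
  proof (induction k)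
    case (Suc k)
    have IH: "0 \<le> e k \<alpha> - e k \<delta>" using nonneg Suc.prems by auto
    have lt: "a * \<alpha> k < 1" using Suc.prems by auto
    then have "0 \<le> (1 - a * \<alpha> k) * (e k \<alpha> - e k \<delta>)"
      using IH by (intro mult_nonneg_nonneg) auto
    moreover have "0 \<le> B * (\<alpha> k - \<delta> k)\<^sup>2" using B by simp
    moreover have "(1 - a * \<alpha> k) * (e k \<alpha> - e k \<delta>) + B * (\<alpha> k - \<delta> k)\<^sup>2 \<le> 0"
      using Suc.prems(2) diff[of k \<alpha>] by linarith
    ultimately have "(1 - a * \<alpha> k) * (e k \<alpha> - e k \<delta>) = 0" "B * (\<alpha> k - \<delta> k)\<^sup>2 = 0"
      by linarith+
    then have "e k \<alpha> = e k \<delta>" "\<alpha> k = \<delta> k" using lt B by auto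
    then show ?case using Suc by (auto simp: less_Suc_eq)
  qed simp
  show "(\<And>j. j < k \<Longrightarrow> \<alpha> j = \<alpha>' j) \<Longrightarrow> e k \<alpha> = e k \<alpha>'"
    by (induction k) (simp_all add: e_0 e_Suc)
qed

section \<open>Convergence of the iterates\<close>

lemma borel_measurable_vecI:
  fixes g :: "'a \<Rightarrow> real ^ 'n"
  assumes "\<And>j. (\<lambda>\<omega>. g \<omega> $ j) \<in> borel_measurable N"
  shows "g \<in> borel_measurable N"
  using assms by (subst borel_measurable_euclidean_space) (auto simp: Basis_vec_def inner_axis)

lemma borel_measurable_vec_nth [measurable (raw)]:
  fixes g :: "'a \<Rightarrow> real ^ 'n"
  assumes "g \<in> borel_measurable N"
  shows "(\<lambda>\<omega>. g \<omega> $ j) \<in> borel_measurable N"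
  by (rule borel_measurable_continuous_on[OF _ assms]) (intro continuous_intros)

context stochastic_approximation
begin

section \<open>The filtration of the history; feasibility and measurability of the iterates\<close>

lemma subalgebra_history: "subalgebra M (history M (x 0) \<xi>s k)"
proof -
  let ?G = "{x 0 -` A \<inter> space M | A. A \<in> sets borel} \<union>
    (\<Union>j<k. {\<xi>s j -` A \<inter> space M | A. A \<in> sets borel})"
  have "?G \<subseteq> sets M"
    using measurable_sets[OF x0_measurable] measurable_sets[OF samples_measurable] by auto
  then have "sigma_sets (space M) ?G \<subseteq> sets M"
    by (rule sets.sigma_sets_subset)
  moreover have "?G \<subseteq> Pow (space M)" by auto
  ultimately show ?thesis
    by (simp add: subalgebra_def history_def space_measure_of_conv)
qed

lemma space_history [simp]: "space (history M (x 0) \<xi>s k) = space M"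
  by (simp add: history_def space_measure_of_conv)

lemma sets_history: "sets (history M (x 0) \<xi>s k) = sigma_sets (space M)
    ({x 0 -` A \<inter> space M | A. A \<in> sets borel} \<union>
     (\<Union>j<k. {\<xi>s j -` A \<inter> space M | A. A \<in> sets borel}))"
  unfolding history_def by (rule sets_measure_of) auto

lemma sets_history_Suc: "sets (history M (x 0) \<xi>s k) \<subseteq> sets (history M (x 0) \<xi>s (Suc k))"
  unfolding sets_history by (intro sigma_sets_mono' Un_mono UN_mono subset_refl) auto

lemma x0_history: "x 0 \<in> borel_measurable (history M (x 0) \<xi>s k)"
  by (rule measurableI) (auto simp: sets_history)

lemma samples_history:
  assumes "j < k"
  shows "\<xi>s j \<in> borel_measurable (history M (x 0) \<xi>s k)"
  using assms by (intro measurableI) (auto simp: sets_history)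

text \<open>Mean map and error add up to the sampled map, which is the map whose joint measurability
  is assumed; measurability of the iterates can thus be proved without the mean map.\<close>

lemma sampled_step:
  assumes "\<omega> \<in> space M"
  shows "block own i (x (Suc k) \<omega>) = closest_point (Xs i)
    (block own i (x k \<omega>) - \<gamma> k i *\<^sub>R block own i (sampled_map own sown f (x k \<omega>) (\<xi>s k \<omega>)))"
proof -
  let ?F = "mean_map M own sown f \<xi> (x k \<omega>)"
  have "block own i ?F + block own i (noise M own sown f \<xi> \<xi>s x k \<omega>)
      = block own i (sampled_map own sown f (x k \<omega>) (\<xi>s k \<omega>))"
    by (auto simp: vec_eq_iff noise_def)
  then show ?thesis using step[OF assms, of i k] by simp
qed

lemma Xs_nonempty: "Xs i \<noteq> {}"
proof -
  obtain \<omega> where "\<omega> \<in> space M" using not_empty by blast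
  then show ?thesis using x0_in by (auto simp: block_prod_def)
qed

lemma iterates_in:
  assumes "\<And>i. closed (Xs i)" "\<omega> \<in> space M"
  shows "x k \<omega> \<in> block_prod own Xs"
proof (cases k)
  case 0
  then show ?thesis using x0_in assms by simp
next
  case (Suc m)
  then show ?thesis
    using assms Xs_nonempty by (auto simp: block_prod_def sampled_step intro: closest_point_in_set)
qed

text \<open>The step from \<open>x k\<close> to \<open>x (Suc k)\<close> uses the sample
  \<open>\<xi>s k\<close>, the last one contained in the history of index \<open>Suc k\<close>. The
  projections are continuous, and feasibility is needed because the sampled map is measurable only
  on \<open>X\<close>.\<close>

lemma iterates_measurable:
  assumes closed: "\<And>i. closed (Xs i)" and convex: "\<And>i. convex (Xs i)"
  shows "x k \<in> borel_measurable (history M (x 0) \<xi>s k)"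
proof (induction k)
  case 0
  show ?case by (rule x0_history)
next
  case (Suc k)
  let ?H = "history M (x 0) \<xi>s (Suc k)"
  let ?s = "\<lambda>\<omega>. sampled_map own sown f (x k \<omega>) (\<xi>s k \<omega>)"
  have xk [measurable]: "x k \<in> borel_measurable ?H"
    using measurable_from_subalg[OF _ Suc, of ?H] sets_history_Suc by (auto simp: subalgebra_def)
  have "x k \<in> measurable ?H (restrict_space borel (block_prod own Xs))"
    using iterates_in[OF closed] by (intro measurable_restrict_space2 xk) auto
  then have "(\<lambda>\<omega>. (x k \<omega>, \<xi>s k \<omega>))
      \<in> measurable ?H (restrict_space borel (block_prod own Xs) \<Otimes>\<^sub>M borel)"
    by (intro measurable_Pair samples_history) auto
  from measurable_compose[OF this sampled_map_measurable]
  have [measurable]: "?s \<in> borel_measurable ?H" by simp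
  show ?case
  proof (rule borel_measurable_vecI)
    fix j
    let ?i = "own j"
    let ?a = "\<lambda>\<omega>. block own ?i (x k \<omega>) - \<gamma> k ?i *\<^sub>R block own ?i (?s \<omega>)"
    have "?a \<in> borel_measurable ?H"
    proof (rule borel_measurable_vecI)
      show "(\<lambda>\<omega>. ?a \<omega> $ l) \<in> borel_measurable ?H" for l
        by (cases "own l = ?i") simp_all
    qed
    then have "(\<lambda>\<omega>. closest_point (Xs ?i) (?a \<omega>)) \<in> borel_measurable ?H"
      by (rule borel_measurable_continuous_on[OF
            continuous_on_closest_point[OF convex closed Xs_nonempty]])
    then have meas: "(\<lambda>\<omega>. closest_point (Xs ?i) (?a \<omega>) $ j) \<in> borel_measurable ?H"
      by (rule borel_measurable_vec_nth)
    have eq: "closest_point (Xs ?i) (?a \<omega>) $ j = x (Suc k) \<omega> $ j" if "\<omega> \<in> space ?H" for \<omega>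
      using arg_cong[OF sampled_step[of \<omega> ?i k], of "\<lambda>v. v $ j"] that by simp
    show "(\<lambda>\<omega>. x (Suc k) \<omega> $ j) \<in> borel_measurable ?H"
      by (rule measurable_cong[THEN iffD1, OF eq meas])
  qed
qed

text \<open>The conditional one-step error estimate, integrated over an arbitrary event of the
  history. Up to the projections, the new deviation from \<open>z\<close> is a noise-free part
  \<open>y\<close> minus the scaled error; the part is contracted, the cross term averages out, and
  the square of the error contributes the \<nu> term.\<close>

lemma step_set_integral_le:
  fixes z :: "real ^ 'n" and d \<beta> \<eta> L \<nu> :: real
  defines "X \<equiv> block_prod own Xs" and "F \<equiv> mean_map M own sown f \<xi>"
  assumes closed: "\<And>i. closed (Xs i)" and convex: "\<And>i. convex (Xs i)"
    and bounded: "bounded X"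
    and strongly_monotone: "strongly_monotone_on \<eta> X F"
    and lipschitz: "lipschitz_on L X F"
    and noise_bound: "AE \<omega> in M. nn_cond_exp M (history M (x 0) \<xi>s k)
        (\<lambda>\<omega>. ennreal ((norm (noise M own sown f \<xi> \<xi>s x k \<omega>))\<^sup>2)) \<omega> \<le> ennreal (\<nu>\<^sup>2)"
    and z: "solves_VI X F z"
    and steps: "\<And>i. d \<le> \<gamma> k i" "\<And>i. \<gamma> k i \<le> (1 + \<beta>) * d"
    and pos: "0 \<le> d" "0 \<le> \<beta>" "\<beta> * L \<le> \<eta>"
    and small: "(1 + \<beta>)\<^sup>2 * L\<^sup>2 * d \<le> \<eta> - \<beta> * L"
    and A: "A \<in> sets (history M (x 0) \<xi>s k)"
  shows "(\<integral>\<omega>. indicator A \<omega> * (norm (x (Suc k) \<omega> - z))\<^sup>2 \<partial>M)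
    \<le> (1 - (\<eta> - \<beta> * L) * d) * (\<integral>\<omega>. indicator A \<omega> * (norm (x k \<omega> - z))\<^sup>2 \<partial>M)
      + (1 + \<beta>)\<^sup>2 * d\<^sup>2 * \<nu>\<^sup>2 * prob A"
proof -
  let ?H = "history M (x 0) \<xi>s k" and ?w = "noise M own sown f \<xi> \<xi>s x k"
  let ?rho = "1 - (\<eta> - \<beta> * L) * d"
  define g :: "real ^ 'n" where "g = (\<chi> j. \<gamma> k (own j))"
  define y where "y \<omega> = x k \<omega> - z - g * (F (x k \<omega>) - F z)" for \<omega>
  have A_M [measurable]: "A \<in> sets M"
    using A subalgebra_history by (auto simp: subalgebra_def)
  note x_H [measurable] = iterates_measurable[OF closed convex]
  have x_M [measurable]: "x l \<in> borel_measurable M" for l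
    by (rule measurable_from_subalg[OF subalgebra_history x_H])
  have xX: "x l \<omega> \<in> X" if "\<omega> \<in> space M" for l \<omega>
    unfolding X_def by (rule iterates_in[OF closed that])
  have zX: "z \<in> X" using z by (simp add: solves_VI_def)
  have dist_le: "norm (x l \<omega> - z) \<le> diameter X" if "\<omega> \<in> space M" for l \<omega>
    using diameter_bounded_bound[OF bounded xX[OF that] zX] by (simp add: dist_norm)
  have F_x: "(\<lambda>\<omega>. F (x k \<omega>)) \<in> borel_measurable ?H"
  proof -
    have "F \<in> borel_measurable (restrict_space borel X)"
      by (intro borel_measurable_continuous_on_restrict lipschitz_on_continuous_on[OF lipschitz])
    moreover have "x k \<in> measurable ?H (restrict_space borel X)"
      using xX by (intro measurable_restrict_space2 x_H) auto
    ultimately show ?thesis by (rule measurable_compose[rotated])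
  qed
  have y_sq: "(norm (y \<omega>))\<^sup>2 \<le> ?rho * (norm (x k \<omega> - z))\<^sup>2" if \<omega>: "\<omega> \<in> space M" for \<omega>
    unfolding y_def
  proof (rule scaled_step_contraction[OF _ _ _ _ pos(1,2) small])
    show "\<eta> * (norm (x k \<omega> - z))\<^sup>2 \<le> (x k \<omega> - z) \<bullet> (F (x k \<omega>) - F z)"
      using strongly_monotone xX[OF \<omega>] zX by (simp add: strongly_monotone_on_def inner_commute)
    show "norm (F (x k \<omega>) - F z) \<le> L * norm (x k \<omega> - z)"
      using lipschitz_onD[OF lipschitz xX[OF \<omega>] zX] by (simp add: dist_norm)
  qed (auto simp: g_def steps)
  \<comment> \<open>This crude bound serves only to make the multiplier of the noise bounded, as
    integrability of the cross term requires.\<close>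
  have y_le: "norm (y \<omega>) \<le> diameter X" if \<omega>: "\<omega> \<in> space M" for \<omega>
  proof -
    have "0 \<le> (\<eta> - \<beta> * L) * d" using pos by simp
    then have "?rho * (norm (x k \<omega> - z))\<^sup>2 \<le> 1 * (norm (x k \<omega> - z))\<^sup>2"
      by (intro mult_right_mono) auto
    with y_sq[OF \<omega>] have "(norm (y \<omega>))\<^sup>2 \<le> (norm (x k \<omega> - z))\<^sup>2"
      unfolding mult_1 by (rule order_trans)
    then have "norm (y \<omega>) \<le> norm (x k \<omega> - z)"
      by (rule power2_le_imp_le) simp
    then show ?thesis using dist_le[OF \<omega>, of k] by linarith
  qed
  have norm_g: "norm (g * v) \<le> ((1 + \<beta>) * d) * norm v" for v
  proof (rule norm_scaled_le)
    show "\<bar>g $ j\<bar> \<le> (1 + \<beta>) * d" for j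
      using order_trans[OF pos(1) steps(1)] steps(2) by (simp add: g_def)
  qed
  \<comment> \<open>Unbiasedness is a statement about real components, hence the inner product with
    the noise is handled coordinate by coordinate.\<close>
  have cross: "integrable M (\<lambda>\<omega>. indicator A \<omega> * (g $ j * y \<omega> $ j) * ?w \<omega> $ j)"
    "expectation (\<lambda>\<omega>. indicator A \<omega> * (g $ j * y \<omega> $ j) * ?w \<omega> $ j) = 0" for j
  proof -
    have meas: "(\<lambda>\<omega>. indicator A \<omega> * (g $ j * y \<omega> $ j)) \<in> borel_measurable ?H"
      unfolding y_def vector_minus_component vector_mult_component using A F_x by measurable
    have bound: "\<bar>indicator A \<omega> * (g $ j * y \<omega> $ j)\<bar> \<le> (1 + \<beta>) * d * diameter X"
      if \<omega>: "\<omega> \<in> space M" for \<omega>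
    proof -
      have "\<bar>indicator A \<omega> * (g $ j * y \<omega> $ j)\<bar> \<le> \<bar>(g * y \<omega>) $ j\<bar>"
        by (auto split: split_indicator)
      also have "\<dots> \<le> norm (g * y \<omega>)" by (rule component_le_norm_cart)
      also have "\<dots> \<le> (1 + \<beta>) * d * norm (y \<omega>)" by (rule norm_g)
      also have "\<dots> \<le> (1 + \<beta>) * d * diameter X"
        using y_le[OF \<omega>] pos by (intro mult_left_mono) auto
      finally show ?thesis .
    qed
    have "integrable M (\<lambda>\<omega>. ?w \<omega> \<bullet> axis j 1)"
      by (intro integrable_inner_left noise_integrable)
    then have w: "integrable M (\<lambda>\<omega>. ?w \<omega> $ j)" by (simp add: inner_axis)
    have c: "AE \<omega> in M. real_cond_exp M ?H (\<lambda>\<omega>. ?w \<omega> $ j) \<omega> = 0"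
      using noise_unbiased[of k] by (auto elim: eventually_mono)
    show "integrable M (\<lambda>\<omega>. indicator A \<omega> * (g $ j * y \<omega> $ j) * ?w \<omega> $ j)"
      by (rule bounded_mult_conditionally_centred(1)[OF subalgebra_history meas bound w c])
    show "expectation (\<lambda>\<omega>. indicator A \<omega> * (g $ j * y \<omega> $ j) * ?w \<omega> $ j) = 0"
      by (rule bounded_mult_conditionally_centred(2)[OF subalgebra_history meas bound w c])
  qed
  have sq_int: "integrable M (\<lambda>\<omega>. indicator A \<omega> * (norm (x l \<omega> - z))\<^sup>2)" for l
  proof (rule integrable_const_bound)
    show "AE \<omega> in M. norm (indicator A \<omega> * (norm (x l \<omega> - z))\<^sup>2) \<le> (diameter X)\<^sup>2"
      using dist_le by (intro AE_I2) (auto split: split_indicator intro!: power_mono)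
  qed measurable
  have w_M: "?w \<in> borel_measurable M" using noise_integrable by auto
  have w_int: "integrable M (\<lambda>\<omega>. indicator A \<omega> * (norm (?w \<omega>))\<^sup>2)"
    using integrable_mult_indicator[OF A_M
        square_integrable_of_nn_cond_exp_bound[OF subalgebra_history w_M noise_bound]] by simp
  have w_le: "(\<integral>\<omega>. indicator A \<omega> * (norm (?w \<omega>))\<^sup>2 \<partial>M) \<le> \<nu>\<^sup>2 * prob A"
    by (rule second_moment_of_nn_cond_exp_bound(2)[OF subalgebra_history w_M noise_bound A])
  let ?c = "\<lambda>\<omega>. \<Sum>j\<in>UNIV. indicator A \<omega> * (g $ j * y \<omega> $ j) * ?w \<omega> $ j"
  have pointwise: "indicator A \<omega> * (norm (x (Suc k) \<omega> - z))\<^sup>2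
    \<le> ?rho * (indicator A \<omega> * (norm (x k \<omega> - z))\<^sup>2) - 2 * ?c \<omega>
      + ((1 + \<beta>) * d)\<^sup>2 * (indicator A \<omega> * (norm (?w \<omega>))\<^sup>2)"
    if \<omega>: "\<omega> \<in> space M" for \<omega>
  proof (cases "\<omega> \<in> A")
    case True
    have "norm (x (Suc k) \<omega> - z) \<le> norm (x k \<omega> - z - (\<chi> j. \<gamma> k (own j)) *
        (sampled_map own sown f (x k \<omega>) (\<xi>s k \<omega>) - F z))"
      using z convex closed Xs_block order_trans[OF pos(1) steps(1)] sampled_step[OF \<omega>]
      unfolding X_def by (rule projected_step_le)
    \<comment> \<open>The sampled map is \<open>F (x k \<omega>)\<close> plus the error; the first
      summand goes into \<open>y\<close>.\<close>
    also have "x k \<omega> - z - (\<chi> j. \<gamma> k (own j)) * (sampled_map own sown f (x k \<omega>) (\<xi>s k \<omega>) - F z)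
        = y \<omega> - g * ?w \<omega>"
      by (simp add: y_def g_def F_def noise_def vec_eq_iff algebra_simps)
    finally have "(norm (x (Suc k) \<omega> - z))\<^sup>2 \<le> (norm (y \<omega> - g * ?w \<omega>))\<^sup>2"
      by (intro power_mono) auto
    also have "\<dots> = (norm (y \<omega>))\<^sup>2 - 2 * (y \<omega> \<bullet> (g * ?w \<omega>)) + (norm (g * ?w \<omega>))\<^sup>2"
      by (simp add: power2_norm_eq_inner algebra_simps inner_commute)
    also have "y \<omega> \<bullet> (g * ?w \<omega>) = ?c \<omega>"
      using True by (simp add: inner_vec_def ac_simps)
    finally have "(norm (x (Suc k) \<omega> - z))\<^sup>2
      \<le> (norm (y \<omega>))\<^sup>2 - 2 * ?c \<omega> + (norm (g * ?w \<omega>))\<^sup>2" .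
    moreover have "(norm (g * ?w \<omega>))\<^sup>2 \<le> ((1 + \<beta>) * d)\<^sup>2 * (norm (?w \<omega>))\<^sup>2"
      using power_mono[OF norm_g, of "?w \<omega>" 2] by (simp add: power_mult_distrib)
    ultimately show ?thesis using y_sq[OF \<omega>] True by simp
  qed simp
  have "(\<integral>\<omega>. indicator A \<omega> * (norm (x (Suc k) \<omega> - z))\<^sup>2 \<partial>M)
    \<le> (\<integral>\<omega>. ?rho * (indicator A \<omega> * (norm (x k \<omega> - z))\<^sup>2) - 2 * ?c \<omega>
      + ((1 + \<beta>) * d)\<^sup>2 * (indicator A \<omega> * (norm (?w \<omega>))\<^sup>2) \<partial>M)"
    by (intro integral_mono pointwise sq_int Bochner_Integration.integrable_add
        Bochner_Integration.integrable_diff integrable_mult_right Bochner_Integration.integrable_sum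
        cross w_int)
  also have "\<dots> = ?rho * (\<integral>\<omega>. indicator A \<omega> * (norm (x k \<omega> - z))\<^sup>2 \<partial>M)
      + ((1 + \<beta>) * d)\<^sup>2 * (\<integral>\<omega>. indicator A \<omega> * (norm (?w \<omega>))\<^sup>2 \<partial>M)"
  proof -
    have c_int: "integrable M ?c" by (intro Bochner_Integration.integrable_sum cross)
    have c_0: "integral\<^sup>L M ?c = 0"
      by (subst Bochner_Integration.integral_sum) (simp_all only: cross sum.neutral_const)
    have "(\<integral>\<omega>. ?rho * (indicator A \<omega> * (norm (x k \<omega> - z))\<^sup>2) - 2 * ?c \<omega>
        + ((1 + \<beta>) * d)\<^sup>2 * (indicator A \<omega> * (norm (?w \<omega>))\<^sup>2) \<partial>M)
      = (\<integral>\<omega>. ?rho * (indicator A \<omega> * (norm (x k \<omega> - z))\<^sup>2) \<partial>M) - (\<integral>\<omega>. 2 * ?c \<omega> \<partial>M)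
        + (\<integral>\<omega>. ((1 + \<beta>) * d)\<^sup>2 * (indicator A \<omega> * (norm (?w \<omega>))\<^sup>2) \<partial>M)"
      using c_int sq_int w_int
      by (subst Bochner_Integration.integral_add Bochner_Integration.integral_diff;
          (intro Bochner_Integration.integrable_diff integrable_mult_right)?)+ auto
    also have "(\<integral>\<omega>. 2 * ?c \<omega> \<partial>M) = 0"
      using c_0 by (simp only: integral_mult_right_zero mult_zero_right)
    finally show ?thesis by (simp only: integral_mult_right_zero diff_zero)
  qed
  also have "\<dots> \<le> ?rho * (\<integral>\<omega>. indicator A \<omega> * (norm (x k \<omega> - z))\<^sup>2 \<partial>M)
      + ((1 + \<beta>) * d)\<^sup>2 * (\<nu>\<^sup>2 * prob A)"
    by (intro add_left_mono mult_left_mono w_le) simp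
  finally show ?thesis by (simp add: power_mult_distrib mult.assoc)
qed

end

context stochastic_approximation
begin

text \<open>The deterministic sequence \<open>E\<close> dominates the mean squared distance to
  \<open>z\<close> and forces it to zero. The same one-step estimate with its contraction factor
  dropped is an almost supermartingale inequality with summable error.\<close>

lemma iterates_tendsto_AE:
  fixes z :: "real ^ 'n" and d :: "nat \<Rightarrow> real" and \<beta> \<eta> L \<nu> :: real
  defines "X \<equiv> block_prod own Xs" and "F \<equiv> mean_map M own sown f \<xi>"
  assumes closed: "\<And>i. closed (Xs i)" and convex: "\<And>i. convex (Xs i)"
    and bounded: "bounded X"
    and strongly_monotone: "strongly_monotone_on \<eta> X F"
    and lipschitz: "lipschitz_on L X F"
    and noise_bound: "\<And>k. AE \<omega> in M. nn_cond_exp M (history M (x 0) \<xi>s k)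
        (\<lambda>\<omega>. ennreal ((norm (noise M own sown f \<xi> \<xi>s x k \<omega>))\<^sup>2)) \<omega> \<le> ennreal (\<nu>\<^sup>2)"
    and z: "solves_VI X F z"
    and steps: "\<And>k i. d k \<le> \<gamma> k i" "\<And>k i. \<gamma> k i \<le> (1 + \<beta>) * d k"
    and pos: "\<And>k. 0 \<le> d k" "0 \<le> \<beta>" "\<beta> * L \<le> \<eta>"
    and small: "\<And>k. (1 + \<beta>)\<^sup>2 * L\<^sup>2 * d k \<le> \<eta> - \<beta> * L"
    and contraction: "\<And>k. (\<eta> - \<beta> * L) * d k \<le> 1"
    and d_summable: "summable (\<lambda>k. (d k)\<^sup>2)"
    and E_0: "(diameter X)\<^sup>2 \<le> E 0"
    and E_Suc: "\<And>k. E (Suc k) = (1 - (\<eta> - \<beta> * L) * d k) * E k + (1 + \<beta>)\<^sup>2 * (d k)\<^sup>2 * \<nu>\<^sup>2"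
    and E_lim: "E \<longlonglongrightarrow> 0"
  shows "AE \<omega> in M. (\<lambda>k. x k \<omega>) \<longlonglongrightarrow> z"
proof -
  let ?H = "\<lambda>k. history M (x 0) \<xi>s k"
  let ?V = "\<lambda>k \<omega>. (norm (x k \<omega> - z))\<^sup>2"
  note step_le = step_set_integral_le[OF closed convex bounded[unfolded X_def]
      strongly_monotone[unfolded X_def F_def] lipschitz[unfolded X_def F_def] noise_bound
      z[unfolded X_def F_def] steps pos small]
  have x_H: "x k \<in> borel_measurable (?H k)" for k
    by (rule iterates_measurable[OF closed convex])
  have V_H [measurable]: "?V k \<in> borel_measurable (?H k)" for k
    using x_H by measurable
  have V_M [measurable]: "?V k \<in> borel_measurable M" for k
    by (rule measurable_from_subalg[OF subalgebra_history V_H])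
  have V_le: "?V k \<omega> \<le> (diameter X)\<^sup>2" if "\<omega> \<in> space M" for k \<omega>
  proof -
    have "x k \<omega> \<in> X" "z \<in> X"
      using iterates_in[OF closed that] z by (auto simp: X_def solves_VI_def)
    from diameter_bounded_bound[OF bounded this] show ?thesis
      by (intro power_mono) (simp_all add: dist_norm)
  qed
  have V_int: "integrable M (?V k)" for k
    by (rule integrable_const_bound[where B = "(diameter X)\<^sup>2"]) (use V_le in auto)
  have mean_le: "expectation (?V k) \<le> E k" for k
  proof (induction k)
    case 0
    have "expectation (?V 0) \<le> expectation (\<lambda>\<omega>. (diameter X)\<^sup>2)"
      using V_le by (intro integral_mono V_int) auto
    then show ?case using E_0 by (simp add: prob_space)
  next
    case (Suc k)
    have top: "(\<integral>\<omega>. indicator (space M) \<omega> * ?V l \<omega> \<partial>M) = expectation (?V l)" for l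
      by (intro Bochner_Integration.integral_cong) auto
    \<comment> \<open>The whole space as event turns the estimate into one for expectations;
      \<open>contraction\<close> keeps the factor nonnegative, so that the induction hypothesis can
      be multiplied by it.\<close>
    have "space M \<in> sets (?H k)"
      using sets.top[of "?H k"] by simp
    from step_le[OF this] have "expectation (?V (Suc k))
        \<le> (1 - (\<eta> - \<beta> * L) * d k) * expectation (?V k) + (1 + \<beta>)\<^sup>2 * (d k)\<^sup>2 * \<nu>\<^sup>2"
      by (simp add: top prob_space)
    also have "\<dots> \<le> E (Suc k)"
      unfolding E_Suc using contraction[of k] by (intro add_right_mono mult_left_mono Suc) simp
    finally show ?case .
  qed
  have "AE \<omega> in M. (\<lambda>k. ?V k \<omega>) \<longlonglongrightarrow> 0"
  proof (rule almost_supermartingale_tendsto_zero[where V = ?V and H = ?H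
        and a = "\<lambda>k. (1 + \<beta>)\<^sup>2 * (d k)\<^sup>2 * \<nu>\<^sup>2",
        OF subalgebra_history sets_history_Suc V_H V_int])
    fix k A assume A: "A \<in> sets (?H k)"
    have "0 \<le> (\<eta> - \<beta> * L) * d k" using pos by simp
    moreover have "0 \<le> (\<integral>\<omega>. indicator A \<omega> * ?V k \<omega> \<partial>M)"
      by (intro integral_nonneg_AE AE_I2) (auto simp: indicator_def)
    ultimately have "(1 - (\<eta> - \<beta> * L) * d k) * (\<integral>\<omega>. indicator A \<omega> * ?V k \<omega> \<partial>M)
        \<le> 1 * (\<integral>\<omega>. indicator A \<omega> * ?V k \<omega> \<partial>M)"
      by (intro mult_right_mono) auto
    with step_le[OF A] show "(\<integral>\<omega>. indicator A \<omega> * ?V (Suc k) \<omega> \<partial>M)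
        \<le> (\<integral>\<omega>. indicator A \<omega> * ?V k \<omega> \<partial>M) + (1 + \<beta>)\<^sup>2 * (d k)\<^sup>2 * \<nu>\<^sup>2 * prob A"
      by linarith
  next
    show "(\<lambda>k. expectation (?V k)) \<longlonglongrightarrow> 0"
      by (rule tendsto_sandwich[OF _ _ tendsto_const E_lim])
        (auto intro!: always_eventually mean_le)
  next
    show "summable (\<lambda>k. (1 + \<beta>)\<^sup>2 * (d k)\<^sup>2 * \<nu>\<^sup>2)"
      by (intro summable_mult summable_mult2 d_summable)
  qed auto
  then show ?thesis
  proof (rule AE_mp, intro AE_I2 impI)
    fix \<omega> assume "(\<lambda>k. ?V k \<omega>) \<longlonglongrightarrow> 0"
    then have "(\<lambda>k. sqrt (?V k \<omega>)) \<longlonglongrightarrow> sqrt 0" by (rule tendsto_real_sqrt)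
    then have "(\<lambda>k. norm (x k \<omega> - z)) \<longlonglongrightarrow> 0" by simp
    then show "(\<lambda>k. x k \<omega>) \<longlonglongrightarrow> z"
      by (simp add: tendsto_norm_zero_iff LIM_zero_iff)
  qed
qed

end

theorem proposition3:
  fixes M :: "'a measure"
    and own :: "'n::finite \<Rightarrow> 'p::finite"
    and sown :: "'d::finite \<Rightarrow> 'p"
    and f :: "'p \<Rightarrow> real ^ 'n \<Rightarrow> real ^ 'd \<Rightarrow> real"
    and \<xi> :: "'a \<Rightarrow> real ^ 'd"
    and Xs :: "'p \<Rightarrow> (real ^ 'n) set"
    and \<gamma> :: "nat \<Rightarrow> 'p \<Rightarrow> real"
    and \<xi>s :: "nat \<Rightarrow> 'a \<Rightarrow> real ^ 'd"
    and x :: "nat \<Rightarrow> 'a \<Rightarrow> real ^ 'n"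
    and X :: "(real ^ 'n) set"
    and F :: "real ^ 'n \<Rightarrow> real ^ 'n"
    and r :: "'p \<Rightarrow> real"
    and \<eta> L \<nu> D c \<beta> e0 :: real
    and \<delta> \<Gamma> :: "nat \<Rightarrow> real"
    and e :: "nat \<Rightarrow> (nat \<Rightarrow> real) \<Rightarrow> real"
    and G :: "nat \<Rightarrow> (nat \<Rightarrow> real) set"
  assumes scheme: "stochastic_approximation M own sown f \<xi> Xs \<gamma> \<xi>s x"
    and X_def: "X = block_prod own Xs"
    and F_def: "F = mean_map M own sown f \<xi>"
    and closed: "\<And>i. closed (Xs i)"
    and convex: "\<And>i. convex (Xs i)"
    and \<eta>_pos: "\<eta> > 0"
    and strongly_monotone: "strongly_monotone_on \<eta> X F"
    and lipschitz: "lipschitz_on L X F"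
    and \<nu>_pos: "\<nu> > 0"
    and noise_bound: "\<And>k. AE \<omega> in M.
      nn_cond_exp M (history M (x 0) \<xi>s k)
        (\<lambda>\<omega>. ennreal ((norm (noise M own sown f \<xi> \<xi>s x k \<omega>))\<^sup>2)) \<omega> \<le> ennreal (\<nu>\<^sup>2)"
    and X_bounded: "bounded X"
    and D_def: "D = diameter X"
    and D_pos: "D > 0"
    and D_less: "D < sqrt 2 * (\<nu> / L)"
    and c: "0 < c" "c < \<eta> / 2"
    and r: "\<And>i. r i \<in> {1..1 + (\<eta> - 2 * c) / L}"
    and \<gamma>_0: "\<And>i. \<gamma> 0 i = r i * (c / ((1 + (\<eta> - 2 * c) / L)\<^sup>2 * \<nu>\<^sup>2)) * D\<^sup>2"
    and \<gamma>_Suc: "\<And>k i. \<gamma> (Suc k) i = \<gamma> k i * (1 - c / r i * \<gamma> k i)"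
    and \<beta>_def: "\<beta> = (\<eta> - 2 * c) / L"
    and e0_def: "e0 = D\<^sup>2"
    and \<delta>_0: "\<delta> 0 = (\<eta> - \<beta> * L) / (2 * (1 + \<beta>)\<^sup>2 * \<nu>\<^sup>2) * e0"
    and \<delta>_Suc: "\<And>k. \<delta> (Suc k) = \<delta> k * (1 - (\<eta> - \<beta> * L) / 2 * \<delta> k)"
    and \<Gamma>_0: "\<Gamma> 0 = (\<eta> - \<beta> * L) / (2 * (1 + \<beta>) * \<nu>\<^sup>2) * e0"
    and \<Gamma>_Suc: "\<And>k. \<Gamma> (Suc k) = \<Gamma> k * (1 - (\<eta> - \<beta> * L) / (2 * (1 + \<beta>)) * \<Gamma> k)"
    and e_0: "\<And>\<alpha>. e 0 \<alpha> = e0"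
    and e_Suc: "\<And>k \<alpha>. e (Suc k) \<alpha> =
      (1 - (\<eta> - \<beta> * L) * \<alpha> k) * e k \<alpha> + (1 + \<beta>)\<^sup>2 * (\<alpha> k)\<^sup>2 * \<nu>\<^sup>2"
    and G_def: "\<And>k. G k = {..<k} \<rightarrow>\<^sub>E {0 <.. (\<eta> - \<beta> * L) / ((1 + \<beta>)\<^sup>2 * L\<^sup>2)}"
  shows "(\<forall>i j k. \<gamma> k i / r i = \<gamma> k j / r j)
    \<and> (0 \<le> \<beta> \<and> \<beta> < \<eta> / L \<and>
       (\<forall>k. \<delta> k > 0 \<and> \<Gamma> k > 0 \<and> \<delta> k \<le> (MIN i. \<gamma> k i) \<and> \<Gamma> k \<ge> (MAX i. \<gamma> k i) \<and>
            (\<Gamma> k - \<delta> k) / \<delta> k \<le> \<beta>))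
    \<and> ((\<exists>!z. solves_VI X F z) \<and>
       (\<forall>z. solves_VI X F z \<longrightarrow> (AE \<omega> in M. (\<lambda>k. x k \<omega>) \<longlonglongrightarrow> z)))
    \<and> ((\<forall>k. e k \<delta> = 2 * (1 + \<beta>)\<^sup>2 * \<nu>\<^sup>2 / (\<eta> - \<beta> * L) * \<delta> k) \<and>
       (\<forall>k\<ge>1. {\<alpha>. is_arg_min (e k) (\<lambda>\<alpha>. \<alpha> \<in> G k) \<alpha>} = {restrict \<delta> {..<k}} \<and>
          (\<forall>\<alpha>\<in>G k. e k \<alpha> - e k \<delta> \<ge> (1 + \<beta>)\<^sup>2 * \<nu>\<^sup>2 * (\<alpha> (k - 1) - \<delta> (k - 1))\<^sup>2)))"
proof -
  interpret stochastic_approximation M own sown f \<xi> Xs \<gamma> \<xi>s x by (rule scheme)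

  \<comment> \<open>Relations between the constants and the admissible range of stepsizes\<close>
  obtain p q where pq: "p \<in> X" "q \<in> X" "p \<noteq> q"
  proof -
    have "\<not> (\<exists>p. X \<subseteq> {p})"
    proof
      assume "\<exists>p. X \<subseteq> {p}"
      then have "X = {} \<or> (\<exists>p. X = {p})" by blast
      then show False using D_pos by (auto simp: D_def)
    qed
    then show thesis using that by blast
  qed
  \<comment> \<open>Two distinct points, available because the diameter is positive, allow strong
    monotonicity and the Lipschitz bound to be compared. Positivity of \<open>L\<close> follows,
    which makes the quotients by \<open>L\<close> genuine.\<close>
  have \<eta>_le_L: "\<eta> \<le> L"
  proof -
    have "\<eta> * (norm (p - q))\<^sup>2 \<le> (F p - F q) \<bullet> (p - q)"
      using strongly_monotone pq by (simp add: strongly_monotone_on_def)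
    also have "\<dots> \<le> norm (F p - F q) * norm (p - q)" by (rule norm_cauchy_schwarz)
    also have "\<dots> \<le> (L * norm (p - q)) * norm (p - q)"
      using lipschitz_onD[OF lipschitz pq(1,2)] by (intro mult_right_mono) (auto simp: dist_norm)
    finally show ?thesis using pq(3) by (simp add: power2_eq_square)
  qed
  then have L_pos: "0 < L" using \<eta>_pos by simp
  have a_eq: "\<eta> - \<beta> * L = 2 * c" using L_pos by (simp add: \<beta>_def)
  have \<beta>: "0 < \<beta>" "\<beta> < \<eta> / L"
    using L_pos c by (simp_all add: \<beta>_def divide_strict_right_mono)
  define B where "B = (1 + \<beta>)\<^sup>2 * \<nu>\<^sup>2"
  have B_pos: "0 < B" using \<beta> \<nu>_pos by (simp add: B_def)
  have \<delta>_0': "\<delta> 0 = c / B * D\<^sup>2"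
    unfolding \<delta>_0 a_eq e0_def B_def by (simp add: field_simps)
  have \<delta>_Suc': "\<delta> (Suc k) = \<delta> k * (1 - c * \<delta> k)" for k
    unfolding \<delta>_Suc a_eq by simp
  have \<delta>_0_pos: "0 < \<delta> 0" unfolding \<delta>_0' using c B_pos D_pos by simp
  have D_sq: "D\<^sup>2 * L\<^sup>2 \<le> 2 * \<nu>\<^sup>2"
  proof -
    have "D * L \<le> sqrt 2 * \<nu>" using D_less L_pos by (simp add: field_simps)
    then have "(D * L)\<^sup>2 \<le> (sqrt 2 * \<nu>)\<^sup>2"
      using D_pos L_pos by (intro power_mono) auto
    then show ?thesis by (simp add: power_mult_distrib)
  qed
  \<comment> \<open>The bound on \<open>D\<close> enters here: it places the first stepsize below
    the upper limit that defines the sets \<open>G k\<close>.\<close>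
  have small_0: "(1 + \<beta>)\<^sup>2 * L\<^sup>2 * \<delta> 0 \<le> 2 * c"
  proof -
    have "(1 + \<beta>)\<^sup>2 * L\<^sup>2 * \<delta> 0 = c / \<nu>\<^sup>2 * (D\<^sup>2 * L\<^sup>2)"
      unfolding \<delta>_0' B_def using \<beta> by simp
    also have "\<dots> \<le> c / \<nu>\<^sup>2 * (2 * \<nu>\<^sup>2)" using c by (intro mult_left_mono D_sq) auto
    also have "\<dots> = 2 * c" using \<nu>_pos by simp
    finally show ?thesis .
  qed
  \<comment> \<open>Because \<open>2 * c\<close> is smaller than \<eta>, which is at most
    \<open>L\<close>, the limit \<open>2 * c / ((1 + \<beta>)\<^sup>2 * L\<^sup>2)\<close> lies
    below \<open>1 / (2 * c)\<close>.\<close>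
  have contraction: "2 * c * t < 1" if "(1 + \<beta>)\<^sup>2 * L\<^sup>2 * t \<le> 2 * c" "0 < t" for t
  proof -
    have "(2 * c)\<^sup>2 < L\<^sup>2" using c \<eta>_le_L by (intro power_strict_mono) auto
    also have "\<dots> \<le> (1 + \<beta>)\<^sup>2 * L\<^sup>2"
      using \<beta> mult_right_mono[of 1 "(1 + \<beta>)\<^sup>2" "L\<^sup>2"] by simp
    finally have "(2 * c)\<^sup>2 * t < (1 + \<beta>)\<^sup>2 * L\<^sup>2 * t" using that(2) by simp
    then have "2 * c * (2 * c * t) < 2 * c * 1"
      using that(1) by (simp add: power2_eq_square)
    then show ?thesis using c by simp
  qed

  \<comment> \<open>Parts (a) and (b): the stepsizes as multiples of one sequence\<close>
  note quad = quadratic_recursion[OF \<delta>_Suc' c(1) \<delta>_0_pos]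
  have c\<delta>_0: "c * \<delta> 0 < 1"
    using contraction[OF small_0 \<delta>_0_pos] mult_pos_pos[OF c(1) \<delta>_0_pos] by linarith
  note \<delta>_pos = quad(1)[OF c\<delta>_0] and \<delta>_le = quad(2)[OF c\<delta>_0]
    and \<delta>_summable = quad(3)[OF c\<delta>_0] and \<delta>_lim = quad(4)[OF c\<delta>_0]
  have small: "(1 + \<beta>)\<^sup>2 * L\<^sup>2 * \<delta> k \<le> 2 * c" for k
    by (rule order_trans[OF mult_left_mono[OF \<delta>_le[of k]] small_0]) simp
  have r_bounds: "1 \<le> r i" "r i \<le> 1 + \<beta>" for i
    using r[of i] by (simp_all add: \<beta>_def)
  have r_pos: "0 < r i" for i using r_bounds(1)[of i] by linarith
  \<comment> \<open>The coefficient \<open>c / r i\<close> cancels the factor \<open>r i\<close>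
    inside the bracket, so all players follow one recursion up to scaling. The upper sequence
    \<Gamma> is the extreme case of scaling by \<open>1 + \<beta>\<close>.\<close>
  have \<gamma>_eq: "\<gamma> k i = r i * \<delta> k" for k i
  proof (induction k)
    case 0
    show ?case unfolding \<gamma>_0 \<delta>_0' B_def \<beta>_def by simp
  next
    case (Suc k)
    show ?case unfolding \<gamma>_Suc \<delta>_Suc' Suc using r_pos[of i] by simp
  qed
  have \<Gamma>_eq: "\<Gamma> k = (1 + \<beta>) * \<delta> k" for k
  proof (induction k)
    case 0
    show ?case unfolding \<Gamma>_0 \<delta>_0 using \<beta> by (simp add: power2_eq_square)
  next
    case (Suc k)
    have "(\<eta> - \<beta> * L) / (2 * (1 + \<beta>)) * ((1 + \<beta>) * \<delta> k) = (\<eta> - \<beta> * L) / 2 * \<delta> k"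
      using \<beta> by (simp add: divide_simps)
    then show ?case unfolding \<Gamma>_Suc \<delta>_Suc Suc by simp
  qed
  have \<gamma>_bounds: "\<delta> k \<le> \<gamma> k i" "\<gamma> k i \<le> (1 + \<beta>) * \<delta> k" for k i
    using mult_right_mono[OF r_bounds(1)[of i], of "\<delta> k"]
      mult_right_mono[OF r_bounds(2)[of i], of "\<delta> k"] \<delta>_pos[of k]
    by (simp_all add: \<gamma>_eq)
  have part_a: "\<forall>i j k. \<gamma> k i / r i = \<gamma> k j / r j"
    using r_pos by (simp add: \<gamma>_eq less_imp_neq[symmetric])
  have part_b: "0 \<le> \<beta> \<and> \<beta> < \<eta> / L \<and>
       (\<forall>k. \<delta> k > 0 \<and> \<Gamma> k > 0 \<and> \<delta> k \<le> (MIN i. \<gamma> k i) \<and> \<Gamma> k \<ge> (MAX i. \<gamma> k i) \<and>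
            (\<Gamma> k - \<delta> k) / \<delta> k \<le> \<beta>)"
  proof (intro conjI allI)
    fix k
    show "0 < \<delta> k" by (rule \<delta>_pos)
    then show "0 < \<Gamma> k" using \<beta> by (simp add: \<Gamma>_eq)
    show "\<delta> k \<le> (MIN i. \<gamma> k i)" using \<gamma>_bounds by (subst Min_ge_iff) auto
    show "\<Gamma> k \<ge> (MAX i. \<gamma> k i)" using \<gamma>_bounds by (subst Max_le_iff) (auto simp: \<Gamma>_eq)
    show "(\<Gamma> k - \<delta> k) / \<delta> k \<le> \<beta>"
      using \<open>0 < \<delta> k\<close> by (simp add: \<Gamma>_eq field_simps)
  qed (use \<beta> in auto)

  \<comment> \<open>Part (d): optimality of the stepsizes for the error bound\<close>
  have e_Suc': "e (Suc k) \<alpha> = (1 - 2 * c * \<alpha> k) * e k \<alpha> + B * (\<alpha> k)\<^sup>2" for k \<alpha>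
    unfolding e_Suc a_eq B_def by simp
  have e_0': "e 0 \<alpha> = 2 * B / (2 * c) * \<delta> 0" for \<alpha>
    unfolding e_0 e0_def \<delta>_0' using c B_pos by simp
  have \<delta>_Suc'': "\<delta> (Suc k) = \<delta> k * (1 - 2 * c / 2 * \<delta> k)" for k
    using \<delta>_Suc' by simp
  note err = error_recursion_optimal[OF e_Suc' e_0' \<delta>_Suc'' _ B_pos]
  have c2: "0 < 2 * c" using c by simp
  have e_\<delta>: "e k \<delta> = 2 * (1 + \<beta>)\<^sup>2 * \<nu>\<^sup>2 / (\<eta> - \<beta> * L) * \<delta> k" for k
    using err(1)[OF c2, of k] by (simp add: a_eq B_def)
  have G_contraction: "2 * c * \<alpha> j < 1" if "\<alpha> \<in> G k" "j < k" for \<alpha> k j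
  proof (rule contraction)
    have "0 < \<alpha> j" "\<alpha> j \<le> 2 * c / ((1 + \<beta>)\<^sup>2 * L\<^sup>2)"
      using that unfolding G_def a_eq by (auto simp: PiE_iff)
    moreover have "0 < (1 + \<beta>)\<^sup>2 * L\<^sup>2" using \<beta> L_pos by simp
    ultimately show "0 < \<alpha> j" "(1 + \<beta>)\<^sup>2 * L\<^sup>2 * \<alpha> j \<le> 2 * c"
      by (simp_all add: pos_le_divide_eq mult.commute)
  qed
  \<comment> \<open>Members of \<open>G k\<close> are extensional functions, a vector of length
    \<open>k\<close> being fixed by its values below \<open>k\<close>. The minimizer must therefore
    be the restriction of \<delta>, and \<open>e k\<close> does not see the difference.\<close>
  have \<delta>_in_G: "restrict \<delta> {..<k} \<in> G k" for k
  proof -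
    have "0 < (1 + \<beta>)\<^sup>2 * L\<^sup>2" using \<beta> L_pos by simp
    then have "\<delta> j \<le> 2 * c / ((1 + \<beta>)\<^sup>2 * L\<^sup>2)" for j
      using small[of j] by (simp add: pos_le_divide_eq mult.commute)
    then show ?thesis unfolding G_def a_eq using \<delta>_pos by auto
  qed
  have e_restrict: "e k (restrict \<delta> {..<k}) = e k \<delta>" for k
    by (rule err(5)[OF c2]) simp
  have G_nonneg: "e k \<delta> \<le> e k \<alpha>" if "\<alpha> \<in> G k" for k \<alpha>
    using err(3)[OF c2, of k \<alpha>] G_contraction[OF that] by simp
  have arg_min: "{\<alpha>. is_arg_min (e k) (\<lambda>\<alpha>. \<alpha> \<in> G k) \<alpha>} = {restrict \<delta> {..<k}}" for k
  proof (intro set_eqI iffI)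
    fix \<alpha> assume "\<alpha> \<in> {\<alpha>. is_arg_min (e k) (\<lambda>\<alpha>. \<alpha> \<in> G k) \<alpha>}"
    then have \<alpha>: "\<alpha> \<in> G k" "e k \<alpha> \<le> e k \<delta>"
      using \<delta>_in_G[of k] e_restrict[of k] by (auto simp: is_arg_min_linorder)
    have "\<alpha> j = \<delta> j" if "j < k" for j
      by (rule err(4)[OF c2 G_contraction[OF \<alpha>(1)] \<alpha>(2) that])
    moreover have "\<alpha> \<in> extensional {..<k}" using \<alpha>(1) by (simp add: G_def PiE_iff)
    ultimately have "\<alpha> = restrict \<delta> {..<k}"
      by (intro extensionalityI[of _ "{..<k}"]) auto
    then show "\<alpha> \<in> {restrict \<delta> {..<k}}" by simp
  next
    fix \<alpha> assume "\<alpha> \<in> {restrict \<delta> {..<k}}"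
    then show "\<alpha> \<in> {\<alpha>. is_arg_min (e k) (\<lambda>\<alpha>. \<alpha> \<in> G k) \<alpha>}"
      using \<delta>_in_G G_nonneg by (simp add: is_arg_min_linorder e_restrict)
  qed
  have gap: "e k \<alpha> - e k \<delta> \<ge> (1 + \<beta>)\<^sup>2 * \<nu>\<^sup>2 * (\<alpha> (k - 1) - \<delta> (k - 1))\<^sup>2"
    if k: "1 \<le> k" and \<alpha>: "\<alpha> \<in> G k" for k \<alpha>
  proof -
    obtain m where m: "k = Suc m" using k by (cases k) auto
    have lt: "2 * c * \<alpha> j < 1" if "j < Suc m" for j
      using G_contraction[OF \<alpha>] that m by simp
    have "0 \<le> (1 - 2 * c * \<alpha> m) * (e m \<alpha> - e m \<delta>)"
      using less_imp_le[OF lt[of m]] err(3)[OF c2, of m \<alpha>] lt by (intro mult_nonneg_nonneg) auto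
    then show ?thesis using err(2)[OF c2, of m \<alpha>] by (simp add: m B_def)
  qed

  \<comment> \<open>Part (c): the variational inequality and almost sure convergence\<close>
  have F_lip: "lipschitz_on L (block_prod own Xs) (mean_map M own sown f \<xi>)"
    and F_mono: "strongly_monotone_on \<eta> (block_prod own Xs) (mean_map M own sown f \<xi>)"
    and bounded: "bounded (block_prod own Xs)"
    using lipschitz strongly_monotone X_bounded by (simp_all add: X_def F_def)
  have "compact X"
    using X_bounded closed by (simp add: compact_eq_bounded_closed X_def closed_block_prod)
  then have "\<exists>z. solves_VI X F z"
    using pq(1) convex lipschitz_on_continuous_on[OF lipschitz]
    by (intro solves_VI_exists) (auto simp: X_def intro: convex_block_prod)
  then have unique: "\<exists>!z. solves_VI X F z"
    using solves_VI_unique[OF strongly_monotone \<eta>_pos] by blast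
  \<comment> \<open>The majorant is \<open>e k \<delta>\<close>: it starts at the squared diameter
    and, being a constant multiple of \<open>\<delta> k\<close>, tends to zero.\<close>
  have converges: "AE \<omega> in M. (\<lambda>k. x k \<omega>) \<longlonglongrightarrow> z" if z: "solves_VI X F z" for z
  proof (rule iterates_tendsto_AE[OF closed convex bounded F_mono F_lip noise_bound
        z[unfolded X_def F_def] \<gamma>_bounds])
    show "(diameter (block_prod own Xs))\<^sup>2 \<le> e 0 \<delta>"
      by (simp add: e_0 e0_def D_def X_def)
    show "(\<lambda>k. e k \<delta>) \<longlonglongrightarrow> 0"
      unfolding e_\<delta> by (rule tendsto_mult_right_zero[OF \<delta>_lim])
    show "(\<eta> - \<beta> * L) * \<delta> k \<le> 1" for k
      unfolding a_eq by (rule less_imp_le[OF contraction[OF small \<delta>_pos]])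
    show "0 \<le> \<delta> k" for k by (rule less_imp_le[OF \<delta>_pos])
    show "0 \<le> \<beta>" using \<beta> by simp
    show "\<beta> * L \<le> \<eta>" using a_eq c by linarith
    show "(1 + \<beta>)\<^sup>2 * L\<^sup>2 * \<delta> k \<le> \<eta> - \<beta> * L" for k
      unfolding a_eq by (rule small)
  qed (fact e_Suc \<delta>_summable)+
  show ?thesis
    using part_a part_b unique converges e_\<delta> arg_min gap by (intro conjI allI impI ballI) auto
qed

end
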